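(* Let $(\Omega_i, \mathcal{A}_i, \mu_i)$, $i=1,\ldots,n$, be probability spaces, and denote by $(\Omega, \mathcal{A}, \mu) := \otimes_{i=1}^n (\Omega_i, \mathcal{A}_i, \mu_i)$ their product. Let $f \colon \Omega \to \mathbb{R}$ be a bounded measurable function whose Hoeffding decomposition with respect to $\mu$ is given by $f = f_1 + \sum_{k=2}^{n} f_k = f_1 + Rf$, where $Rf:=\sum_{k=2}^n f_k$ (in particular $\int f\,d\mu=0$). Suppose that $|\mathfrak{d} f_1| \le b_0$ for some $b_0 \ge 0$ and that $$|\mathfrak{d}|\mathfrak{d} Rf|| \le 1 \qquad\text{and}\qquad \int \lVert \mathfrak{d}^{(2)} f \rVert_{\mathrm{HS}}^2\, d\mu \le b^2$$ for some $b \ge 0$. Then $$\int \exp\left(\frac{1}{12+4b^2+7b_0}|f|\right) d\mu \le 2.$$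
   Context: Let $(\Omega,\mathcal A,\mu)=\otimes_{i=1}^n(\Omega_i,\mathcal A_i,\mu_i)$ be a product of probability spaces. For $f\in L^2(\mu)$ and $i=1,\ldots,n$ set $$\mathfrak{d}_i f(x) := \Big(\tfrac12\int_{\Omega_i}(f(x)-f(x_1,\ldots,x_{i-1},y_i,x_{i+1},\ldots,x_n))^2\mu_i(dy_i)\Big)^{1/2},$$ $\mathfrak{d}f:=(\mathfrak{d}_1f,\ldots,\mathfrak{d}_nf)$, and let $|\mathfrak d f|$ be its Euclidean norm, a function on $\Omega$. $|\mathfrak{d}|\mathfrak{d}g||$ is the Euclidean norm of $\mathfrak{d}$ applied to the function $|\mathfrak{d}g|$; bounds on $|\mathfrak d f_1|$ and $|\mathfrak{d}|\mathfrak{d}Rf||$ are pointwise. For $i\neq j$ set $$\mathfrak{d}_{ij}f(x):=\Big(\tfrac14\int_{\Omega_i}\int_{\Omega_j}\big(f(x)-f(\ldots,y_i,\ldots)-f(\ldots,y_j,\ldots)+f(\ldots,y_i,\ldots,y_j,\ldots)\big)^2\mu_i(dy_i)\mu_j(dy_j)\Big)^{1/2},$$ where in the arguments the indicated coordinates $x_i$ and/or $x_j$ of $x$ are replaced by $y_i$ and/or $y_j$ and the other coordinates of $x$ are kept. $\mathfrak{d}^{(2)}f$ is the $n\times n$ matrix with entries $\mathfrak{d}_{ij}f$ for $i\ne j$ and $0$ on the diagonal. $\lVert A\rVert_{\mathrm{HS}}=(\sum_{i,j}|a_{ij}|^2)^{1/2}$. Hoeffding decomposition: every $f\in L^1(\mu)$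 has a unique decomposition $f=f_0+f_1+\ldots+f_n$ with $f_0=\int f\,d\mu$ and $f_k(x)=\sum_{i_1<\ldots<i_k}h_{i_1\ldots i_k}(x_{i_1},\ldots,x_{i_k})$ such that $\int h_{i_1\ldots i_k}(x_{i_1},\ldots,x_{i_k})\,\mu_{i_j}(dx_{i_j})=0$ for all $k=1,\ldots,n$, all $i_1<\ldots<i_k$ and all $j\in\{1,\ldots,k\}$. $f_k$ is called the $k$-th Hoeffding term of $f$. *)

theory Defs
  imports "HOL-Probability.Probability"
begin

text \<open>
  The factors are \<open>M 1, \<dots>, M n\<close> and the product space is \<open>Pi\<^sub>M {1..n} M\<close>. A point of it is
  an extensional function on \<open>{1..n}\<close>, and \<open>x(i := y)\<close> is the point \<open>x\<close> with its \<open>i\<close>-th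
  coordinate replaced by \<open>y\<close>.
\<close>

definition diff1 :: "(nat \<Rightarrow> 'a measure) \<Rightarrow> nat \<Rightarrow> ((nat \<Rightarrow> 'a) \<Rightarrow> real) \<Rightarrow> (nat \<Rightarrow> 'a) \<Rightarrow> real" where
  "diff1 M i f x = sqrt (1/2 * (\<integral>y. (f x - f (x(i := y)))\<^sup>2 \<partial>M i))"

definition grad_norm ::
    "nat \<Rightarrow> (nat \<Rightarrow> 'a measure) \<Rightarrow> ((nat \<Rightarrow> 'a) \<Rightarrow> real) \<Rightarrow> (nat \<Rightarrow> 'a) \<Rightarrow> real" where
  "grad_norm n M f x = L2_set (\<lambda>i. diff1 M i f x) {1..n}"

definition diff2 ::
    "(nat \<Rightarrow> 'a measure) \<Rightarrow> nat \<Rightarrow> nat \<Rightarrow> ((nat \<Rightarrow> 'a) \<Rightarrow> real) \<Rightarrow> (nat \<Rightarrow> 'a) \<Rightarrow> real" where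
  "diff2 M i j f x =
     sqrt (1/4 * (\<integral>yi. (\<integral>yj. (f x - f (x(i := yi)) - f (x(j := yj)) + f (x(i := yi, j := yj)))\<^sup>2
                   \<partial>M j) \<partial>M i))"

definition hess :: "(nat \<Rightarrow> 'a measure) \<Rightarrow> ((nat \<Rightarrow> 'a) \<Rightarrow> real) \<Rightarrow> (nat \<Rightarrow> 'a) \<Rightarrow> nat \<Rightarrow> nat \<Rightarrow> real" where
  "hess M f x i j = (if i = j then 0 else diff2 M i j f x)"

definition hs_norm :: "nat \<Rightarrow> (nat \<Rightarrow> nat \<Rightarrow> real) \<Rightarrow> real" where
  "hs_norm n A = sqrt (\<Sum>i\<in>{1..n}. \<Sum>j\<in>{1..n}. \<bar>A i j\<bar>\<^sup>2)"

text \<open>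
  A family of kernels is indexed by the sets \<open>S = {i\<^sub>1 < \<dots> < i\<^sub>k}\<close>; the kernel \<open>h S\<close> is a function
  on \<open>Pi\<^sub>M S M\<close>.
\<close>

definition hoeffding_term ::
    "nat \<Rightarrow> (nat set \<Rightarrow> (nat \<Rightarrow> 'a) \<Rightarrow> real) \<Rightarrow> nat \<Rightarrow> (nat \<Rightarrow> 'a) \<Rightarrow> real" where
  "hoeffding_term n h k x = (\<Sum>S | S \<subseteq> {1..n} \<and> card S = k. h S (restrict x S))"

text \<open>
  The decomposition is one in \<open>L\<^sup>1\<close>: the kernels are integrable, and all identities hold almost
  everywhere. It determines the kernels up to null sets.
\<close>

definition hoeffding_decomposition ::
    "nat \<Rightarrow> (nat \<Rightarrow> 'a measure) \<Rightarrow> ((nat \<Rightarrow> 'a) \<Rightarrow> real)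
      \<Rightarrow> (nat set \<Rightarrow> (nat \<Rightarrow> 'a) \<Rightarrow> real) \<Rightarrow> bool" where
  "hoeffding_decomposition n M f h \<longleftrightarrow>
     (\<forall>S. S \<subseteq> {1..n} \<and> S \<noteq> {} \<longrightarrow> integrable (Pi\<^sub>M S M) (h S)) \<and>
     (\<forall>S j. S \<subseteq> {1..n} \<and> j \<in> S \<longrightarrow>
        (AE x in Pi\<^sub>M S M. (\<integral>y. h S (x(j := y)) \<partial>M j) = 0)) \<and>
     (AE x in Pi\<^sub>M {1..n} M.
        f x = (\<integral>z. f z \<partial>Pi\<^sub>M {1..n} M) + (\<Sum>k\<in>{1..n}. hoeffding_term n h k x))"

definition hoeffding_remainder ::
    "nat \<Rightarrow> (nat set \<Rightarrow> (nat \<Rightarrow> 'a) \<Rightarrow> real) \<Rightarrow> (nat \<Rightarrow> 'a) \<Rightarrow> real" where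
  "hoeffding_remainder n h x = (\<Sum>k\<in>{2..n}. hoeffding_term n h k x)"

end

theory Submission
  imports Defs
begin

text \<open>
  On a product of arbitrary probability spaces the difference operator \<open>d\<close> satisfies a modified
  logarithmic Sobolev inequality \<open>Ent (exp g) \<le> \<integral> |dg|\<^sup>2 exp g\<close>: entropy is subadditive over the
  coordinates, and in one coordinate the bound is an elementary inequality for
  \<open>(exp a - exp b) (a - b)\<close>, symmetrised under the exchange of a coordinate with an independent
  copy (\<open>modified_log_sobolev\<close>).

  Herbst's argument turns this into bounds on exponential moments at two levels. Together with the
  variational formula for entropy it gives \<open>log E exp (s f) \<le> log E exp (2 s\<^sup>2 |df|\<^sup>2)\<close> for centred
  \<open>f\<close> (\<open>log_mgf_le_gradient\<close>). By the triangle inequality \<open>|df|\<^sup>2 \<le> 2 b0\<^sup>2 + 2 u\<^sup>2\<close> with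
  \<open>u = |dRf|\<close>, and since \<open>|du| \<le> 1\<close>, Herbst's argument applied to \<open>u\<^sup>2\<close> bounds
  \<open>log E exp (c u\<^sup>2)\<close> by a multiple of \<open>c \<integral> u\<^sup>2\<close> (\<open>square_exponential_moment\<close>).

  It remains to see that \<open>\<integral> u\<^sup>2 \<le> \<integral> \<parallel>d\<^sup>2 f\<parallel>\<^sup>2 \<le> b\<^sup>2\<close> (\<open>higher_order_part_energy\<close>). The fluctuation
  of \<open>Rf\<close> in coordinate \<open>j\<close> has mean zero over all other coordinates, because the part of \<open>f\<close> that
  depends on \<open>x\<^sub>j\<close> alone was removed; so the Efron-Stein inequality in the other coordinates bounds
  its second moment by those of the mixed fluctuations in \<open>i\<close> and \<open>j\<close>, which are the entries of
  \<open>d\<^sup>2 f\<close>. With \<open>s = 3/2 / (12 + 4 b\<^sup>2 + 7 b0)\<close> both \<open>E exp (s f)\<close> and \<open>E exp (- s f)\<close> come out at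
  most \<open>\<surd>2\<close>, and lowering the exponent by the factor \<open>2/3\<close> gives the bound \<open>2\<close>.

  The Hoeffding kernels are determined only up to null sets and need not be bounded, whereas all of
  the above is carried out for bounded functions. The first-order kernels are therefore identified
  almost everywhere with the conditional expectations of \<open>f\<close> given one coordinate
  (\<open>main_effect_unique\<close>), and the pointwise hypotheses are carried over to these bounded versions.
\<close>

section \<open>Bounded measurable functions\<close>

text \<open>
  The bound is required on the space of the measure only: off that space a function on a product
  has values without meaning.
\<close>

definition bounded_measurable :: "'b measure \<Rightarrow> ('b \<Rightarrow> real) \<Rightarrow> bool" where
  "bounded_measurable N g \<longleftrightarrow> g \<in> borel_measurable N \<and> (\<exists>C. \<forall>x\<in>space N. \<bar>g x\<bar> \<le> C)"

lemma bounded_measurableI: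
  "g \<in> borel_measurable N \<Longrightarrow> (\<And>x. x \<in> space N \<Longrightarrow> \<bar>g x\<bar> \<le> C) \<Longrightarrow> bounded_measurable N g"
  by (auto simp: bounded_measurable_def)

lemma bounded_measurable_measurable: "bounded_measurable N g \<Longrightarrow> g \<in> borel_measurable N"
  by (simp add: bounded_measurable_def)

lemma bounded_measurable_bound:
  assumes "bounded_measurable N g"
  obtains C where "C > 0" "\<And>x. x \<in> space N \<Longrightarrow> \<bar>g x\<bar> \<le> C"
proof -
  obtain C where "\<And>x. x \<in> space N \<Longrightarrow> \<bar>g x\<bar> \<le> C"
    using assms by (auto simp: bounded_measurable_def)
  then show ?thesis using that[of "max C 1"] by (meson less_max_iff_disj max.coboundedI1 zero_less_one)
qed

named_theorems bm_intros

lemma bm_const [bm_intros]: "bounded_measurable N (\<lambda>x. c)"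
  by (rule bounded_measurableI[where C = "\<bar>c\<bar>"]) auto

lemma bm_continuous:
  assumes "bounded_measurable N g" and F: "\<And>C. continuous_on {-C..C} F"
    and [measurable]: "F \<in> borel_measurable borel"
  shows "bounded_measurable N (\<lambda>x. F (g x))"
proof -
  have [measurable]: "g \<in> borel_measurable N" using assms(1) by (rule bounded_measurable_measurable)
  obtain C where C: "\<And>x. x \<in> space N \<Longrightarrow> \<bar>g x\<bar> \<le> C"
    using bounded_measurable_bound[OF assms(1)] by metis
  have "bounded (F ` {-C..C})"
    using compact_continuous_image[OF F] compact_imp_bounded by blast
  then obtain B where "\<forall>x\<in>{-C..C}. \<bar>F x\<bar> \<le> B" by (metis bounded_iff image_eqI real_norm_def)
  moreover have "g x \<in> {-C..C}" if "x \<in> space N" for x using C[OF that] by (simp add: abs_le_iff)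
  ultimately show ?thesis by (intro bounded_measurableI[where C=B]) auto
qed

lemma bm_add [bm_intros]:
  assumes "bounded_measurable N g" "bounded_measurable N k"
  shows "bounded_measurable N (\<lambda>x. g x + k x)"
proof -
  obtain C D where "\<And>x. x \<in> space N \<Longrightarrow> \<bar>g x\<bar> \<le> C" "\<And>x. x \<in> space N \<Longrightarrow> \<bar>k x\<bar> \<le> D"
    using assms by (metis bounded_measurable_bound)
  then show ?thesis
    using assms[THEN bounded_measurable_measurable]
    by (intro bounded_measurableI[where C="C+D"]) (auto intro: order.trans[OF abs_triangle_ineq] add_mono)
qed

lemma bm_mult [bm_intros]:
  assumes "bounded_measurable N g" "bounded_measurable N k"
  shows "bounded_measurable N (\<lambda>x. g x * k x)"
proof -
  obtain C D where "C>0" "\<And>x. x \<in> space N \<Longrightarrow> \<bar>g x\<bar> \<le> C" "\<And>x. x \<in> space N \<Longrightarrow> \<bar>k x\<bar> \<le> D"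
    using assms by (metis bounded_measurable_bound)
  then show ?thesis
    using assms[THEN bounded_measurable_measurable]
    by (intro bounded_measurableI[where C="C*D"]) (auto simp: abs_mult intro: mult_mono)
qed

lemma bm_uminus [bm_intros]: "bounded_measurable N g \<Longrightarrow> bounded_measurable N (\<lambda>x. - g x)"
  using bm_mult[OF bm_const[of N "-1"]] by auto

lemma bm_diff [bm_intros]:
  "bounded_measurable N g \<Longrightarrow> bounded_measurable N k \<Longrightarrow> bounded_measurable N (\<lambda>x. g x - k x)"
  using bm_add[OF _ bm_uminus] by fastforce

lemma bm_power [bm_intros]: "bounded_measurable N g \<Longrightarrow> bounded_measurable N (\<lambda>x. g x ^ m)"
  by (induction m) (auto intro: bm_intros)

lemma bm_exp [bm_intros]: "bounded_measurable N g \<Longrightarrow> bounded_measurable N (\<lambda>x. exp (g x))"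
  by (rule bm_continuous[where F=exp]) (auto intro!: continuous_intros)

lemma bm_sqrt [bm_intros]: "bounded_measurable N g \<Longrightarrow> bounded_measurable N (\<lambda>x. sqrt (g x))"
  by (rule bm_continuous[where F=sqrt]) (auto intro!: continuous_intros)

lemma bm_abs [bm_intros]: "bounded_measurable N g \<Longrightarrow> bounded_measurable N (\<lambda>x. \<bar>g x\<bar>)"
  by (rule bm_continuous[where F=abs]) (auto intro!: continuous_intros)

lemma bm_sum [bm_intros]:
  "(\<And>i. i \<in> I \<Longrightarrow> bounded_measurable N (g i)) \<Longrightarrow> bounded_measurable N (\<lambda>x. \<Sum>i\<in>I. g i x)"
  by (induction I rule: infinite_finite_induct) (auto intro: bm_intros)

lemma bm_cong:
  "bounded_measurable N g \<Longrightarrow> (\<And>x. x \<in> space N \<Longrightarrow> g x = k x) \<Longrightarrow> bounded_measurable N k"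
  unfolding bounded_measurable_def using measurable_cong[of N g k borel] by auto

lemma bm_lower_ln:
  assumes "bounded_measurable N g" "c > 0" "\<And>x. x \<in> space N \<Longrightarrow> c \<le> g x"
  shows "bounded_measurable N (\<lambda>x. ln (g x))"
proof -
  have [measurable]: "g \<in> borel_measurable N" using assms(1) by (rule bounded_measurable_measurable)
  obtain C where C: "\<And>x. x \<in> space N \<Longrightarrow> \<bar>g x\<bar> \<le> C"
    using bounded_measurable_bound[OF assms(1)] by metis
  show ?thesis
  proof (rule bounded_measurableI)
    fix x assume x: "x \<in> space N"
    have "ln c \<le> ln (g x)" "ln (g x) \<le> ln C"
      using assms(2) assms(3)[OF x] C[OF x] by auto
    then show "\<bar>ln (g x)\<bar> \<le> \<bar>ln c\<bar> + \<bar>ln C\<bar>" by linarith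
  qed measurable
qed

lemma bm_lower_divide:
  assumes "bounded_measurable N f" "bounded_measurable N g" "c > 0" "\<And>x. x \<in> space N \<Longrightarrow> c \<le> g x"
  shows "bounded_measurable N (\<lambda>x. f x / g x)"
proof -
  have [measurable]: "g \<in> borel_measurable N" using assms(2) by (rule bounded_measurable_measurable)
  have "bounded_measurable N (\<lambda>x. 1 / g x)"
  proof (rule bounded_measurableI)
    fix x assume x: "x \<in> space N"
    show "\<bar>1 / g x\<bar> \<le> 1 / c" using assms(3) assms(4)[OF x] by (simp add: frac_le)
  qed measurable
  then show ?thesis using bm_mult[OF assms(1)] by fastforce
qed

lemma (in prob_space) bm_integrable [bm_intros]:
  assumes "bounded_measurable M g" shows "integrable M g"
  using assms bounded_measurable_bound[OF assms]
  by (metis (no_types, lifting) bounded_measurable_measurable integrable_const_bound AE_I2 real_norm_def)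

section \<open>Exponential moments and Herbst's argument\<close>

lemma exp_minus_linear_bounds:
  fixes a :: real
  assumes "a \<le> 1/2" shows "0 \<le> exp a - 1 - a" "exp a - 1 - a \<le> 2 * a\<^sup>2"
proof -
  show "0 \<le> exp a - 1 - a" using exp_ge_add_one_self[of a] by linarith
  have "exp a * (1 - a) \<le> exp a * exp (-a)"
    using exp_ge_add_one_self[of "-a"] by (intro mult_left_mono) auto
  then have "exp a * (1 - a) \<le> 1" by (simp add: exp_minus)
  then have "(exp a - 1 - a) * (1 - a) \<le> a\<^sup>2" by (simp add: algebra_simps power2_eq_square)
  also have "\<dots> \<le> 2 * a\<^sup>2 * (1 - a)"
    using mult_left_mono[of "1/2" "1-a" "2*a\<^sup>2"] assms by simp
  finally show "exp a - 1 - a \<le> 2 * a\<^sup>2" using assms by (simp add: mult_le_cancel_right)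
qed

context prob_space
begin

abbreviation mgf :: "('a \<Rightarrow> real) \<Rightarrow> real \<Rightarrow> real" where
  "mgf X t \<equiv> expectation (\<lambda>x. exp (t * X x))"

text \<open>
  For a bounded variable the integrand has a second-order Taylor remainder that is uniform over the
  space, so the difference quotients converge under the integral.
\<close>

lemma mgf_has_derivative:
  assumes X: "bounded_measurable M X"
  shows "(mgf X has_real_derivative expectation (\<lambda>x. X x * exp (t * X x))) (at t)"
proof -
  obtain C where C: "C > 0" "\<And>x. x \<in> space M \<Longrightarrow> \<bar>X x\<bar> \<le> C"
    using bounded_measurable_bound[OF X] by metis
  let ?D = "expectation (\<lambda>x. X x * exp (t * X x))"
  let ?K = "exp (\<bar>t\<bar> * C) * (2 * C\<^sup>2)"
  have bd: "\<bar>(mgf X (t + h) - mgf X t) / h - ?D\<bar> \<le> ?K * \<bar>h\<bar>"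
    if h: "h \<noteq> 0" "\<bar>h\<bar> < 1 / (2 * C)" for h
  proof -
    have le: "norm (exp (t * X x) * (exp (h * X x) - 1 - h * X x)) \<le> ?K * h\<^sup>2" if x: "x \<in> space M" for x
    proof -
      have a: "\<bar>h * X x\<bar> \<le> \<bar>h\<bar> * C" using C(2)[OF x] by (simp add: abs_mult mult_left_mono)
      also have "\<dots> \<le> 1/2" using h C by (simp add: field_simps)
      finally have a2: "h * X x \<le> 1/2" by linarith
      have "(h * X x)\<^sup>2 \<le> (\<bar>h\<bar> * C)\<^sup>2" using power_mono[OF a, of 2] by simp
      then have b: "\<bar>exp (h * X x) - 1 - h * X x\<bar> \<le> 2 * C\<^sup>2 * h\<^sup>2"
        using exp_minus_linear_bounds[OF a2] by (simp add: power_mult_distrib mult_ac)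
      have "t * X x \<le> \<bar>t\<bar> * C"
        using abs_ge_self[of "t * X x"] mult_left_mono[OF C(2)[OF x], of "\<bar>t\<bar>"] by (simp add: abs_mult)
      then have "exp (t * X x) \<le> exp (\<bar>t\<bar> * C)" by simp
      then have "exp (t * X x) * \<bar>exp (h * X x) - 1 - h * X x\<bar> \<le> exp (\<bar>t\<bar> * C) * (2 * C\<^sup>2 * h\<^sup>2)"
        using b by (intro mult_mono) auto
      then show ?thesis by (simp add: abs_mult mult_ac)
    qed
    have "mgf X (t + h) - mgf X t - h * ?D =
        expectation (\<lambda>x. exp ((t + h) * X x) - exp (t * X x) - h * (X x * exp (t * X x)))"
      by (subst Bochner_Integration.integral_diff Bochner_Integration.integral_mult_right_zero | intro bm_intros X)+ (rule refl)
    also have "\<dots> = expectation (\<lambda>x. exp (t * X x) * (exp (h * X x) - 1 - h * X x))"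
      by (intro Bochner_Integration.integral_cong) (auto simp: algebra_simps exp_add)
    finally have eq: "mgf X (t + h) - mgf X t - h * ?D = \<dots>" .
    have "norm (expectation (\<lambda>x. exp (t * X x) * (exp (h * X x) - 1 - h * X x))) \<le> ?K * h\<^sup>2"
      using le X by (intro order.trans[OF integral_norm_bound] integral_le_const bm_intros integrable_norm) auto
    then have "\<bar>mgf X (t + h) - mgf X t - h * ?D\<bar> \<le> ?K * h\<^sup>2" using eq by simp
    then have "\<bar>(mgf X (t + h) - mgf X t - h * ?D) / h\<bar> \<le> ?K * h\<^sup>2 / \<bar>h\<bar>"
      by (simp add: abs_divide divide_right_mono)
    moreover have "(mgf X (t + h) - mgf X t - h * ?D) / h = (mgf X (t + h) - mgf X t) / h - ?D"
      using h by (simp add: field_simps)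
    moreover have "?K * h\<^sup>2 / \<bar>h\<bar> = ?K * \<bar>h\<bar>" using h by (simp add: power2_eq_square field_simps)
    ultimately show ?thesis by simp
  qed
  have "((\<lambda>h. (mgf X (t + h) - mgf X t) / h - ?D) \<longlongrightarrow> 0) (at 0)"
  proof (rule Lim_null_comparison)
    show "\<forall>\<^sub>F h in at 0. norm ((mgf X (t + h) - mgf X t) / h - ?D) \<le> ?K * \<bar>h\<bar>"
      unfolding eventually_at using bd C by (intro exI[of _ "1/(2*C)"]) (auto simp: dist_real_def)
    show "((\<lambda>h. ?K * \<bar>h\<bar>) \<longlongrightarrow> 0) (at 0)" by (auto intro!: tendsto_eq_intros)
  qed
  then show ?thesis by (simp add: DERIV_def LIM_zero_iff)
qed

lemma mgf_pos:
  assumes "bounded_measurable M X" shows "mgf X t > 0"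
proof (rule expectation_greater)
  show "integrable M (\<lambda>x. exp (t * X x))" by (intro bm_intros assms)
  show "AE x in M. 0 < exp (t * X x)" by (intro AE_I2) (rule exp_gt_zero)
qed

end

lemma nonincreasing_le_right_limit:
  fixes m :: "real \<Rightarrow> real"
  assumes "s > 0" and der: "\<And>t. 0 < t \<Longrightarrow> t \<le> s \<Longrightarrow> (m has_real_derivative m' t) (at t)"
    and neg: "\<And>t. 0 < t \<Longrightarrow> t \<le> s \<Longrightarrow> m' t \<le> 0" and lim: "(m \<longlongrightarrow> L) (at_right 0)"
  shows "m s \<le> L"
proof (rule tendsto_lowerbound[OF lim])
  have "m s \<le> m e" if "0 < e" "e < s" for e
    using that der neg by (intro DERIV_nonpos_imp_nonincreasing[of e s m]) (auto, meson less_le_trans)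
  then show "\<forall>\<^sub>F e in at_right 0. m s \<le> m e"
    using \<open>s > 0\<close> eventually_at_right_less[of "0::real"] eventually_at_right_field by blast
qed simp

context prob_space
begin

text \<open>
  The heart of Herbst's argument: the slope \<open>log E exp (t X) / t\<close> has derivative
  \<open>Ent (exp (t X)) / (t\<^sup>2 E exp (t X))\<close>, so that a bound on entropy is a differential inequality for
  the slope, and integrating it from \<open>0\<close>, where the slope is \<open>E X\<close>, bounds the exponential moment.
\<close>

lemma log_mgf_slope_has_derivative:
  assumes X: "bounded_measurable M X" and t: "t > 0"
  shows "((\<lambda>t. ln (mgf X t) / t) has_real_derivative
    (t * expectation (\<lambda>x. X x * exp (t * X x)) - mgf X t * ln (mgf X t)) / (t\<^sup>2 * mgf X t)) (at t)"
  using t mgf_pos[OF X, of t]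
  by (auto intro!: derivative_eq_intros mgf_has_derivative[OF X] simp: field_simps power2_eq_square)

lemma log_mgf_slope_tendsto:
  assumes X: "bounded_measurable M X"
  shows "((\<lambda>t. ln (mgf X t) / t) \<longlongrightarrow> expectation X) (at_right 0)"
proof -
  have "((\<lambda>t. ln (mgf X t)) has_real_derivative expectation X) (at 0)"
    using mgf_has_derivative[OF X, of 0]
    by (auto intro!: derivative_eq_intros simp: prob_space)
  then have "((\<lambda>t. ln (mgf X t) / t) \<longlongrightarrow> expectation X) (at 0)"
    by (simp add: DERIV_def prob_space)
  then show ?thesis by (rule tendsto_within_subset) simp
qed

lemma herbst_constant_energy:
  assumes X: "bounded_measurable M X" and s: "s > 0"
    and ent: "\<And>t. 0 < t \<Longrightarrow> t \<le> s \<Longrightarrow>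
      t * expectation (\<lambda>x. X x * exp (t * X x)) - mgf X t * ln (mgf X t) \<le> B * t\<^sup>2 * mgf X t"
  shows "ln (mgf X s) \<le> s * expectation X + B * s\<^sup>2"
proof -
  let ?E = "\<lambda>t. t * expectation (\<lambda>x. X x * exp (t * X x)) - mgf X t * ln (mgf X t)"
  have "ln (mgf X s) / s - B * s \<le> expectation X"
  proof (rule nonincreasing_le_right_limit[OF s])
    fix t :: real assume t: "0 < t" "t \<le> s"
    show "((\<lambda>t. ln (mgf X t) / t - B * t) has_real_derivative ?E t / (t\<^sup>2 * mgf X t) - B) (at t)"
      using t by (intro DERIV_diff log_mgf_slope_has_derivative X)
        (auto intro!: derivative_eq_intros)
    have "?E t / (t\<^sup>2 * mgf X t) \<le> B"
      using ent[OF t] t mgf_pos[OF X, of t] by (simp add: divide_le_eq mult_ac)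
    then show "?E t / (t\<^sup>2 * mgf X t) - B \<le> 0" by simp
  next
    have "((\<lambda>t. ln (mgf X t) / t - B * t) \<longlongrightarrow> expectation X - B * 0) (at_right 0)"
      by (intro tendsto_intros log_mgf_slope_tendsto X)
    then show "((\<lambda>t. ln (mgf X t) / t - B * t) \<longlongrightarrow> expectation X) (at_right 0)" by simp
  qed
  then show ?thesis using s by (simp add: field_simps power2_eq_square)
qed

text \<open>
  Here the entropy is bounded in terms of the derivative \<open>E (X exp (t X))\<close> of the exponential
  moment itself. The derivative of the slope multiplied by \<open>1 - \<kappa> t\<close> is then exactly the entropy
  minus its bound, over \<open>t\<^sup>2 E exp (t X)\<close>, hence nonpositive.
\<close>

lemma herbst_self_bounding:
  assumes X: "bounded_measurable M X" and s: "s > 0" "\<kappa> * s < 1"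
    and ent: "\<And>t. 0 < t \<Longrightarrow> t \<le> s \<Longrightarrow>
      t * expectation (\<lambda>x. X x * exp (t * X x)) - mgf X t * ln (mgf X t)
        \<le> \<kappa> * t\<^sup>2 * expectation (\<lambda>x. X x * exp (t * X x))"
  shows "ln (mgf X s) \<le> s * expectation X / (1 - \<kappa> * s)"
proof -
  let ?T = "\<lambda>t. expectation (\<lambda>x. X x * exp (t * X x))"
  let ?E = "\<lambda>t. t * ?T t - mgf X t * ln (mgf X t)"
  have "ln (mgf X s) / s * (1 - \<kappa> * s) \<le> expectation X"
  proof (rule nonincreasing_le_right_limit[OF s(1)])
    fix t :: real assume t: "0 < t" "t \<le> s"
    let ?d = "?E t / (t\<^sup>2 * mgf X t) * (1 - \<kappa> * t) + (- \<kappa>) * (ln (mgf X t) / t)"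
    show "((\<lambda>t. ln (mgf X t) / t * (1 - \<kappa> * t)) has_real_derivative ?d) (at t)"
      using t by (intro DERIV_mult log_mgf_slope_has_derivative X)
        (auto intro!: derivative_eq_intros)
    have "?d = (?E t - \<kappa> * t\<^sup>2 * ?T t) / (t\<^sup>2 * mgf X t)"
      using t mgf_pos[OF X, of t] by (simp add: field_simps power2_eq_square)
    also have "\<dots> \<le> 0"
      using ent[OF t] mgf_pos[OF X, of t] by (intro divide_nonpos_nonneg) auto
    finally show "?d \<le> 0" .
  next
    have "((\<lambda>t. ln (mgf X t) / t * (1 - \<kappa> * t)) \<longlongrightarrow> expectation X * (1 - \<kappa> * 0)) (at_right 0)"
      by (intro tendsto_intros log_mgf_slope_tendsto X)
    then show "((\<lambda>t. ln (mgf X t) / t * (1 - \<kappa> * t)) \<longlongrightarrow> expectation X) (at_right 0)" by simp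
  qed
  then show ?thesis using s by (simp add: field_simps)
qed

text \<open>
  The inequality \<open>log z \<le> z - 1\<close> in the form that yields variational bounds for entropy: after
  integration the right-hand side vanishes as soon as \<open>exp v\<close> and \<open>exp g\<close> have averages \<open>c\<close>
  and \<open>a\<close>.
\<close>

lemma log_ratio_le:
  fixes a b c v g :: real
  assumes "a > 0" "c > 0"
  shows "exp g * (v - ln c - g + ln a) \<le> exp v * (a / c) - exp g"
proof -
  have "v - ln c - g + ln a = ln (exp (v - g) * (a / c))"
    using assms by (simp add: ln_mult ln_div)
  also have "\<dots> \<le> exp (v - g) * (a / c) - 1" using assms by (intro ln_le_minus_one) simp
  finally have "exp g * (v - ln c - g + ln a) \<le> exp g * (exp (v - g) * (a / c) - 1)"
    by (intro mult_left_mono) auto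
  also have "\<dots> = exp v * (a / c) - exp g" by (simp add: exp_diff algebra_simps)
  finally show ?thesis .
qed

text \<open>
  The half of the Gibbs variational principle that allows \<open>E (V exp g)\<close> to be estimated by an
  exponential moment of \<open>V\<close> at the price of the entropy of \<open>exp g\<close>.
\<close>

lemma entropy_duality:
  assumes g: "bounded_measurable M g" and V: "bounded_measurable M V"
  shows "expectation (\<lambda>x. V x * exp (g x)) \<le>
    expectation (\<lambda>x. g x * exp (g x)) - expectation (\<lambda>x. exp (g x)) * ln (expectation (\<lambda>x. exp (g x)))
      + expectation (\<lambda>x. exp (g x)) * ln (expectation (\<lambda>x. exp (V x)))"
proof -
  define a where "a = expectation (\<lambda>x. exp (g x))"
  define c where "c = expectation (\<lambda>x. exp (V x))"
  have pos: "a > 0" "c > 0" using mgf_pos[OF g, of 1] mgf_pos[OF V, of 1] by (simp_all add: a_def c_def)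
  have "expectation (\<lambda>x. exp (g x) * (V x - ln c - g x + ln a)) \<le> expectation (\<lambda>x. exp (V x) * (a / c) - exp (g x))"
    by (intro integral_mono log_ratio_le pos bm_intros g V)
  also have "\<dots> = 0"
    using pos g V by (simp add: bm_intros a_def[symmetric] c_def[symmetric])
  also have "expectation (\<lambda>x. exp (g x) * (V x - ln c - g x + ln a)) =
      expectation (\<lambda>x. V x * exp (g x) - g x * exp (g x) + exp (g x) * (ln a - ln c))"
    by (intro Bochner_Integration.integral_cong) (auto simp: algebra_simps)
  also have "\<dots> = expectation (\<lambda>x. V x * exp (g x)) - expectation (\<lambda>x. g x * exp (g x)) + a * (ln a - ln c)"
    using g V by (simp add: bm_intros a_def[symmetric])
  finally show ?thesis unfolding a_def[symmetric] c_def[symmetric] by (simp add: algebra_simps)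
qed

text \<open>
  With \<open>Y = exp (3/2 c |X|)\<close> the hypotheses give \<open>E Y \<le> 2 \<surd>2\<close>, and \<open>z \<mapsto> z powr (2/3)\<close> is concave
  and takes the value \<open>2\<close> at \<open>2 \<surd>2\<close>. Jensen's inequality is replaced by the tangent of this
  function at \<open>2 \<surd>2\<close>, written for \<open>z = Y powr (1/3)\<close> to stay with integer powers.
\<close>

lemma exp_abs_moment_le_2:
  assumes X: "bounded_measurable M X"
    and pos: "mgf X (3 / 2 * c) \<le> sqrt 2" and neg: "mgf (\<lambda>x. - X x) (3 / 2 * c) \<le> sqrt 2"
  shows "expectation (\<lambda>x. exp (c * \<bar>X x\<bar>)) \<le> 2"
proof -
  have tangent: "z\<^sup>2 \<le> 2 / 3 + sqrt 2 / 3 * z ^ 3" if "z \<ge> 0" for z :: real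
  proof -
    have "0 \<le> (z - sqrt 2)\<^sup>2 * (sqrt 2 * z + 1)" using that by simp
    also have "\<dots> = sqrt 2 * z ^ 3 - 3 * z\<^sup>2 + 2"
    proof -
      have "(z - w)\<^sup>2 * (w * z + 1) = w * z ^ 3 + z\<^sup>2 - 2 * (w * w) * z\<^sup>2 - 2 * w * z + (w * w) * (w * z) + w * w"
        for w by (simp add: power2_eq_square power3_eq_cube algebra_simps)
      from this[of "sqrt 2"] show ?thesis by simp
    qed
    finally show ?thesis by simp
  qed
  let ?s = "3 / 2 * c"
  have le: "exp (c * \<bar>X x\<bar>) \<le> 2 / 3 + sqrt 2 / 3 * (exp (?s * X x) + exp (?s * - X x))" for x
  proof -
    have "exp (c * \<bar>X x\<bar>) = (exp (c / 2 * \<bar>X x\<bar>))\<^sup>2" by (simp flip: exp_double)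
    also have "\<dots> \<le> 2 / 3 + sqrt 2 / 3 * exp (c / 2 * \<bar>X x\<bar>) ^ 3" by (rule tangent) simp
    also have "exp (c / 2 * \<bar>X x\<bar>) ^ 3 = exp (?s * \<bar>X x\<bar>)" by (simp flip: exp_of_nat_mult)
    also have "\<dots> \<le> exp (?s * X x) + exp (?s * - X x)"
      using exp_ge_zero[of "?s * X x"] exp_ge_zero[of "?s * - X x"] by (cases "X x \<ge> 0") (auto simp del: exp_ge_zero)
    finally show ?thesis by simp
  qed
  have "expectation (\<lambda>x. exp (c * \<bar>X x\<bar>)) \<le>
      expectation (\<lambda>x. 2 / 3 + sqrt 2 / 3 * (exp (?s * X x) + exp (?s * - X x)))"
    by (intro integral_mono le bm_intros X)
  also have "\<dots> = 2 / 3 + sqrt 2 / 3 * (mgf X ?s + mgf (\<lambda>x. - X x) ?s)"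
  proof -
    have "integrable M (\<lambda>x. exp (?s * X x))" "integrable M (\<lambda>x. exp (?s * - X x))"
      by (intro bm_intros X)+
    then show ?thesis
      by (subst Bochner_Integration.integral_add integral_mult_right_zero | simp add: prob_space)+
  qed
  also have "\<dots> \<le> 2 / 3 + sqrt 2 / 3 * (sqrt 2 + sqrt 2)"
    using pos neg by (intro add_left_mono mult_left_mono add_mono) auto
  also have "\<dots> = 2"
    using real_sqrt_mult_self[of 2] by (simp add: field_simps)
  finally show ?thesis .
qed

end

section \<open>Averaging over coordinates\<close>

locale finite_product_prob =
  fixes I :: "nat set" and M :: "nat \<Rightarrow> 'a measure"
  assumes finite_index: "finite I" and prob_factor: "i \<in> I \<Longrightarrow> prob_space (M i)"
begin

abbreviation P :: "(nat \<Rightarrow> 'a) measure" where "P \<equiv> Pi\<^sub>M I M"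

sublocale prob_space P by (rule prob_space_PiM) (rule prob_factor)

abbreviation bm :: "((nat \<Rightarrow> 'a) \<Rightarrow> real) \<Rightarrow> bool" where "bm \<equiv> bounded_measurable P"

lemma upd_space: "x \<in> space P \<Longrightarrow> i \<in> I \<Longrightarrow> y \<in> space (M i) \<Longrightarrow> x(i := y) \<in> space P"
  by (auto simp: space_PiM PiE_iff extensional_def)

lemma upd_measurable: "i \<in> I \<Longrightarrow> (\<lambda>(x, y). x(i := y)) \<in> P \<Otimes>\<^sub>M M i \<rightarrow>\<^sub>M P"
  using measurable_add_dim[of i "I" M] by (simp add: insert_absorb)

lemma upd_measurable': 
  assumes "i \<in> I" "x \<in> space P" shows "(\<lambda>y. x(i := y)) \<in> M i \<rightarrow>\<^sub>M P"
  using measurable_compose[OF measurable_Pair1'[OF assms(2)] upd_measurable[OF assms(1)]] by simp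

text \<open>
  Resampling a coordinate does not change the law. All properties of the averaging operators below,
  and the transfer of null sets to the fibres, come from this.
\<close>

lemma distr_upd:
  assumes i: "i \<in> I"
  shows "distr (P \<Otimes>\<^sub>M M i) P (\<lambda>(x, y). x(i := y)) = P"
proof -
  interpret Mi: prob_space "M i" using i by (rule prob_factor)
  let ?J = "I - {i}"
  interpret J: prob_space "Pi\<^sub>M ?J M" by (rule prob_space_PiM) (auto intro: prob_factor)
  interpret PM: pair_prob_space P "M i" ..
  have ins: "insert i ?J = I" using i by auto
  show ?thesis
  proof (rule measure_eqI_PiM_finite[symmetric])
    show "sets P = sets (Pi\<^sub>M I M)" "sets (distr (P \<Otimes>\<^sub>M M i) P (\<lambda>(x, y). x(i := y))) = sets (Pi\<^sub>M I M)"
      by auto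
    show "range (\<lambda>_::nat. space P) \<subseteq> prod_algebra I M"
      using prod_algebraI_finite[OF finite_index, of "\<lambda>i. space (M i)" M] by (auto simp: space_PiM)
    show "(\<Union>i::nat. space P) = space P" by simp
    show "emeasure P (space P) \<noteq> \<infinity>" for i :: nat using emeasure_space_1 by simp
    fix A assume A: "\<And>j. j \<in> I \<Longrightarrow> A j \<in> sets (M j)"
    let ?B = "A(i := space (M i))"
    have B: "\<And>j. j \<in> I \<Longrightarrow> ?B j \<in> sets (M j)" using A by auto
    have emb: "prod_emb I M I (Pi\<^sub>E I C) = Pi\<^sub>E I C"
      if "\<And>j. j \<in> I \<Longrightarrow> C j \<in> sets (M j)" for C
      using that by (intro prod_emb_PiE_same_index) (auto dest: sets.sets_into_space)
    have em: "emeasure P (Pi\<^sub>E I C) = (\<Prod>j\<in>I. emeasure (M j) (C j))"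
      if C: "\<And>j. j \<in> I \<Longrightarrow> C j \<in> sets (M j)" for C
      using emeasure_PiM_emb[of I M I C, OF prob_factor subset_refl finite_index C] by (simp only: emb[OF C])
    have sA: "Pi\<^sub>E I C \<in> sets P" if "\<And>j. j \<in> I \<Longrightarrow> C j \<in> sets (M j)" for C
      using that finite_index by (intro sets_PiM_I_finite)
    have pre: "(\<lambda>(x, y). x(i := y)) -` Pi\<^sub>E I A \<inter> space (P \<Otimes>\<^sub>M M i) = Pi\<^sub>E I ?B \<times> A i"
    proof (intro set_eqI iffI)
      fix z assume "z \<in> (\<lambda>(x, y). x(i := y)) -` Pi\<^sub>E I A \<inter> space (P \<Otimes>\<^sub>M M i)"
      then obtain x y where z: "z = (x, y)" and x: "x \<in> space P" and xy: "x(i := y) \<in> Pi\<^sub>E I A"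
        by (cases z) (auto simp: space_pair_measure)
      have "y \<in> A i" using PiE_mem[OF xy i] by simp
      moreover have "x j \<in> ?B j" if "j \<in> I" for j
        using PiE_mem[OF xy that] PiE_mem[of x I "\<lambda>i. space (M i)" j] x that by (cases "j = i") (auto simp: space_PiM)
      ultimately show "z \<in> Pi\<^sub>E I ?B \<times> A i" using x z by (auto simp: space_PiM PiE_iff)
    next
      fix z assume "z \<in> Pi\<^sub>E I ?B \<times> A i"
      then obtain x y where z: "z = (x, y)" and x: "x \<in> Pi\<^sub>E I ?B" and y: "y \<in> A i" by auto
      have "x \<in> space P" using x sets.sets_into_space[OF B] unfolding space_PiM by (auto simp: PiE_iff simp del: fun_upd_apply)
      moreover have "x(i := y) \<in> Pi\<^sub>E I A" using x y i by (auto simp: PiE_iff extensional_def split: if_splits)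
      ultimately show "z \<in> (\<lambda>(x, y). x(i := y)) -` Pi\<^sub>E I A \<inter> space (P \<Otimes>\<^sub>M M i)"
        using z y A[OF i, THEN sets.sets_into_space] by (auto simp: space_pair_measure)
    qed
    have "emeasure (distr (P \<Otimes>\<^sub>M M i) P (\<lambda>(x, y). x(i := y))) (Pi\<^sub>E I A)
        = emeasure (P \<Otimes>\<^sub>M M i) (Pi\<^sub>E I ?B \<times> A i)"
      by (subst emeasure_distr[OF upd_measurable[OF i] sA[OF A]]) (simp_all only: pre)
    also have "\<dots> = emeasure P (Pi\<^sub>E I ?B) * emeasure (M i) (A i)"
      by (rule Mi.emeasure_pair_measure_Times[OF sA[OF B] A[OF i]])
    also have "\<dots> = (\<Prod>j\<in>I. emeasure (M j) (?B j)) * emeasure (M i) (A i)"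
      by (simp only: em[OF B])
    also have "\<dots> = (\<Prod>j\<in>I. emeasure (M j) (A j))"
      using i finite_index by (simp add: prod.remove[of I i] Mi.emeasure_space_1 mult.commute)
    finally show "emeasure P (Pi\<^sub>E I A) = emeasure (distr (P \<Otimes>\<^sub>M M i) P (\<lambda>(x, y). x(i := y))) (Pi\<^sub>E I A)"
      by (simp only: em[OF A])
  qed (use finite_index in auto)
qed

definition avg :: "nat \<Rightarrow> ((nat \<Rightarrow> 'a) \<Rightarrow> real) \<Rightarrow> (nat \<Rightarrow> 'a) \<Rightarrow> real" where
  "avg i g x = (\<integral>y. g (x(i := y)) \<partial>M i)"

lemma AE_upd:
  assumes i: "i \<in> I" and "AE x in P. Q x"
  shows "AE x in P. AE y in M i. Q (x(i := y))"
proof -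
  interpret Mi: prob_space "M i" using i by (rule prob_factor)
  interpret PM: pair_prob_space P "M i" ..
  have "AE x in distr (P \<Otimes>\<^sub>M M i) P (\<lambda>(x, y). x(i := y)). Q x" using assms by (simp only: distr_upd)
  then have "AE z in P \<Otimes>\<^sub>M M i. Q (case z of (x, y) \<Rightarrow> x(i := y))"
    by (rule AE_distrD[OF upd_measurable[OF i]])
  then have "AE x in P. AE y in M i. Q (case (x, y) of (x, y) \<Rightarrow> x(i := y))"
    by (rule PM.AE_pair)
  then show ?thesis by simp
qed

lemma integrable_upd:
  fixes g :: "(nat \<Rightarrow> 'a) \<Rightarrow> real"
  assumes i: "i \<in> I" and g: "integrable P g"
  shows "integrable (P \<Otimes>\<^sub>M M i) (\<lambda>(x, y). g (x(i := y)))"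
proof -
  have "integrable (distr (P \<Otimes>\<^sub>M M i) P (\<lambda>(x, y). x(i := y))) g" using g by (simp add: distr_upd i)
  then have "integrable (P \<Otimes>\<^sub>M M i) (\<lambda>z. g (case z of (x, y) \<Rightarrow> x(i := y)))"
    using integrable_distr[OF upd_measurable[OF i], of g] by blast
  then show ?thesis by (simp add: case_prod_beta')
qed

lemma expectation_avg:
  assumes i: "i \<in> I" and g: "integrable P g"
  shows "expectation (avg i g) = expectation g"
proof -
  interpret Mi: prob_space "M i" using i by (rule prob_factor)
  interpret PM: pair_prob_space P "M i" ..
  have "expectation g = (\<integral>x. g x \<partial>distr (P \<Otimes>\<^sub>M M i) P (\<lambda>(x, y). x(i := y)))" by (simp add: distr_upd i)
  also have "\<dots> = (\<integral>z. g (case z of (x, y) \<Rightarrow> x(i := y)) \<partial>(P \<Otimes>\<^sub>M M i))"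
    using g by (intro integral_distr upd_measurable i) auto
  also have "\<dots> = (\<integral>z. (case z of (x, y) \<Rightarrow> g (x(i := y))) \<partial>(P \<Otimes>\<^sub>M M i))" by (simp add: case_prod_beta)
  also have "\<dots> = (\<integral>x. \<integral>y. g (x(i := y)) \<partial>M i \<partial>P)"
    using PM.integral_fst'[OF integrable_upd[OF i g]] by simp
  finally show ?thesis by (simp add: avg_def[abs_def])
qed

lemma bm_fiber:
  assumes "bm g" "i \<in> I" "x \<in> space P"
  shows "bounded_measurable (M i) (\<lambda>y. g (x(i := y)))"
proof -
  obtain C where C: "\<And>x. x \<in> space P \<Longrightarrow> \<bar>g x\<bar> \<le> C"
    using bounded_measurable_bound[OF assms(1)] by metis
  show ?thesis
    using measurable_compose[OF upd_measurable'[OF assms(2,3)] bounded_measurable_measurable[OF assms(1)]]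
    by (intro bounded_measurableI[of _ _ C] C upd_space assms)
qed

lemma fiber_integrable:
  assumes "bm g" "i \<in> I" "x \<in> space P"
  shows "integrable (M i) (\<lambda>y. g (x(i := y)))"
  using prob_space.bm_integrable[OF prob_factor bm_fiber] assms by blast

lemma measurable_avg:
  assumes i: "i \<in> I" and [measurable]: "g \<in> borel_measurable P"
  shows "avg i g \<in> borel_measurable P"
proof -
  interpret Mi: prob_space "M i" using i by (rule prob_factor)
  have "(\<lambda>(x, y). g (x(i := y))) \<in> borel_measurable (P \<Otimes>\<^sub>M M i)"
    using measurable_compose[OF upd_measurable[OF i], of g borel] by (simp add: case_prod_beta')
  then show ?thesis unfolding avg_def[abs_def] by (rule Mi.borel_measurable_lebesgue_integral)
qed

lemma avg_bounds:
  assumes "bm g" "i \<in> I" "x \<in> space P" "\<And>z. z \<in> space P \<Longrightarrow> c \<le> g z" 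
  shows "c \<le> avg i g x"
proof -
  interpret Mi: prob_space "M i" using assms(2) by (rule prob_factor)
  show ?thesis unfolding avg_def
    by (intro Mi.integral_ge_const fiber_integrable assms) (auto intro!: AE_I2 assms upd_space)
qed

lemma bm_avg [bm_intros]:
  assumes g: "bm g" and i: "i \<in> I"
  shows "bm (avg i g)"
proof -
  interpret Mi: prob_space "M i" using i by (rule prob_factor)
  obtain C where C: "\<And>x. x \<in> space P \<Longrightarrow> \<bar>g x\<bar> \<le> C"
    using bounded_measurable_bound[OF g] by metis
  show ?thesis
  proof (rule bounded_measurableI[of _ _ C])
    show "avg i g \<in> borel_measurable P" 
      by (intro measurable_avg i bounded_measurable_measurable g)
    fix x assume x: "x \<in> space P"
    have "\<bar>avg i g x\<bar> \<le> (\<integral>y. \<bar>g (x(i := y))\<bar> \<partial>M i)" unfolding avg_def by (rule integral_abs_bound)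
    also have "\<dots> \<le> C"
      by (intro Mi.integral_le_const integrable_abs fiber_integrable g i x AE_I2 C upd_space)
    finally show "\<bar>avg i g x\<bar> \<le> C" .
  qed
qed

lemma avg_cong:
  assumes "i \<in> I" "x \<in> space P" "\<And>z. z \<in> space P \<Longrightarrow> f z = g z"
  shows "avg i f x = avg i g x"
  unfolding avg_def by (intro Bochner_Integration.integral_cong) (auto intro!: assms(3) upd_space assms)

lemma avg_diff:
  assumes "bm f" "bm g" "i \<in> I" "x \<in> space P"
  shows "avg i (\<lambda>x. f x - g x) x = avg i f x - avg i g x"
  unfolding avg_def using assms by (intro Bochner_Integration.integral_diff fiber_integrable)

text \<open>
  Independence is required at every point and not just almost everywhere. This is what averages
  satisfy, and it is what makes \<open>indep_all_const\<close> hold at every point.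
\<close>

definition indep_coord :: "nat \<Rightarrow> ((nat \<Rightarrow> 'a) \<Rightarrow> real) \<Rightarrow> bool" where
  "indep_coord i g \<longleftrightarrow> (\<forall>x\<in>space P. \<forall>y\<in>space (M i). g (x(i := y)) = g x)"

lemma indep_avg_same: "i \<in> I \<Longrightarrow> indep_coord i (avg i g)"
  by (simp add: indep_coord_def avg_def)

lemma indep_avg:
  assumes "indep_coord j g" "i \<in> I" "j \<in> I" shows "indep_coord j (avg i g)"
proof (cases "i = j")
  case False
  show ?thesis unfolding indep_coord_def avg_def
  proof (intro ballI Bochner_Integration.integral_cong refl)
    fix x y z assume *: "x \<in> space P" "y \<in> space (M j)" "z \<in> space (M i)"
    have "x(j := y, i := z) = x(i := z, j := y)" using False by (simp add: fun_upd_twist)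
    then show "g (x(j := y, i := z)) = g (x(i := z))"
      using assms * by (auto simp: indep_coord_def upd_space)
  qed
qed (use assms indep_avg_same in simp)

lemma indep_coordD: "indep_coord i g \<Longrightarrow> x \<in> space P \<Longrightarrow> y \<in> space (M i) \<Longrightarrow> g (x(i := y)) = g x"
  by (simp add: indep_coord_def)

lemma avg_mult_indep:
  assumes "indep_coord i a" "i \<in> I" "x \<in> space P"
  shows "avg i (\<lambda>x. a x * g x) x = a x * avg i g x"
proof -
  have "avg i (\<lambda>x. a x * g x) x = (\<integral>y. a x * g (x(i := y)) \<partial>M i)" unfolding avg_def
    by (intro Bochner_Integration.integral_cong) (auto simp: indep_coordD[OF assms(1,3)])
  then show ?thesis by (simp add: avg_def)
qed

lemma avg_of_indep:
  assumes "indep_coord i a" "i \<in> I" "x \<in> space P"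
  shows "avg i a x = a x"
proof -
  interpret Mi: prob_space "M i" using assms(2) by (rule prob_factor)
  show ?thesis using avg_mult_indep[OF assms, of "\<lambda>_. 1"] by (simp add: avg_def Mi.prob_space)
qed

text \<open>
  Averaging over a coordinate is an orthogonal projection in \<open>L\<^sup>2\<close>; this lemma and the next one are
  the form in which idempotence and self-adjointness enter below.
\<close>

lemma expectation_mult_avg:
  assumes "bm f" "bm g" "i \<in> I"
  shows "expectation (\<lambda>x. avg i f x * g x) = expectation (\<lambda>x. avg i f x * avg i g x)"
proof -
  have "expectation (\<lambda>x. avg i f x * g x) = expectation (avg i (\<lambda>x. avg i f x * g x))"
    using assms by (intro expectation_avg[symmetric] bm_intros)
  also have "\<dots> = expectation (\<lambda>x. avg i f x * avg i g x)"
    by (intro Bochner_Integration.integral_cong refl avg_mult_indep indep_avg_same assms)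
  finally show ?thesis .
qed

lemma avg_selfadjoint:
  assumes "bm f" "bm g" "i \<in> I"
  shows "expectation (\<lambda>x. avg i f x * g x) = expectation (\<lambda>x. f x * avg i g x)"
  using expectation_mult_avg[OF assms] expectation_mult_avg[OF assms(2,1,3)] by (simp add: mult.commute)

text \<open>
  Any two points of a finite product are joined by changing one coordinate at a time.
\<close>

lemma indep_all_const:
  assumes ind: "\<And>i. i \<in> I \<Longrightarrow> indep_coord i g" and x: "x \<in> space P"
  shows "g x = expectation g"
proof -
  have const: "g x' = g x" if x': "x' \<in> space P" for x'
  proof -
    \<comment> \<open>replace the coordinates in \<open>J\<close>, enlarging \<open>J\<close> one index at a time\<close>
    let ?mix = "\<lambda>J i. if i \<in> J then x' i else x i"
    have "?mix J \<in> space P \<and> g (?mix J) = g x" if "finite J" "J \<subseteq> I" for J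
      using that
    proof (induction J rule: finite_induct)
      case (insert j J)
      have eq: "?mix (insert j J) = (?mix J)(j := x' j)" using insert.hyps by auto
      have "x' j \<in> space (M j)" using insert.prems x' by (auto simp: space_PiM)
      then show ?case unfolding eq using insert x' 
        by (intro conjI upd_space) (auto simp: indep_coordD[OF ind])
    qed (use x in simp)
    from this[OF finite_index subset_refl] have "g (?mix I) = g x" by blast
    moreover have "?mix I = x'" using x x' by (auto simp: space_PiM PiE_iff extensional_def fun_eq_iff)
    ultimately show ?thesis by simp
  qed
  have "expectation g = expectation (\<lambda>_. g x)"
    by (intro Bochner_Integration.integral_cong refl const)
  then show ?thesis by (simp add: prob_space)
qed

text \<open>
  Averaging over several coordinates is iterated averaging, recorded by the list of coordinates; a
  list carries the order in which the inductive arguments peel coordinates off.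
\<close>

primrec avgs :: "nat list \<Rightarrow> ((nat \<Rightarrow> 'a) \<Rightarrow> real) \<Rightarrow> (nat \<Rightarrow> 'a) \<Rightarrow> real" where
  "avgs [] g = g"
| "avgs (k # ks) g = avg k (avgs ks g)"

lemma bm_avgs [bm_intros]: "bm g \<Longrightarrow> set ks \<subseteq> I \<Longrightarrow> bm (avgs ks g)"
  by (induction ks) (auto intro: bm_avg)

lemma indep_avgs: "indep_coord j g \<Longrightarrow> set ks \<subseteq> I \<Longrightarrow> j \<in> I \<Longrightarrow> indep_coord j (avgs ks g)"
  by (induction ks) (auto intro: indep_avg)

lemma indep_avgs_mem: "set ks \<subseteq> I \<Longrightarrow> j \<in> set ks \<Longrightarrow> indep_coord j (avgs ks g)"
  by (induction ks) (auto intro: indep_avg indep_avg_same dest: subsetD)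

lemma avgs_mult_indep:
  "set ks \<subseteq> I \<Longrightarrow> (\<And>k. k \<in> set ks \<Longrightarrow> indep_coord k a) \<Longrightarrow> x \<in> space P \<Longrightarrow>
    avgs ks (\<lambda>x. a x * g x) x = a x * avgs ks g x"
proof (induction ks arbitrary: x)
  case (Cons k ks)
  have "avg k (avgs ks (\<lambda>x. a x * g x)) x = avg k (\<lambda>x. a x * avgs ks g x) x"
    by (rule avg_cong) (use Cons in auto)
  then show ?case using Cons.prems by (simp add: avg_mult_indep)
qed simp

lemma avgs_const: "set ks \<subseteq> I \<Longrightarrow> x \<in> space P \<Longrightarrow> avgs ks (\<lambda>_. c) x = c"
proof (induction ks arbitrary: x)
  case (Cons k ks)
  have "avg k (avgs ks (\<lambda>_. c)) x = avg k (\<lambda>_. c) x"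
    by (rule avg_cong) (use Cons in auto)
  then show ?case using Cons.prems by (simp add: avg_of_indep indep_coord_def)
qed simp

lemma avgs_of_indep:
  "set ks \<subseteq> I \<Longrightarrow> (\<And>k. k \<in> set ks \<Longrightarrow> indep_coord k a) \<Longrightarrow> x \<in> space P \<Longrightarrow> avgs ks a x = a x"
  using avgs_mult_indep[of ks a x "\<lambda>_. 1"] by (simp add: avgs_const)

lemma avgs_diff:
  "set ks \<subseteq> I \<Longrightarrow> bm f \<Longrightarrow> bm g \<Longrightarrow> x \<in> space P \<Longrightarrow>
    avgs ks (\<lambda>x. f x - g x) x = avgs ks f x - avgs ks g x"
proof (induction ks arbitrary: x)
  case (Cons k ks)
  have "avg k (avgs ks (\<lambda>x. f x - g x)) x = avg k (\<lambda>x. avgs ks f x - avgs ks g x) x"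
    by (rule avg_cong) (use Cons in auto)
  then show ?case using Cons.prems by (simp add: avg_diff bm_avgs)
qed simp

lemma expectation_avgs: "set ks \<subseteq> I \<Longrightarrow> bm g \<Longrightarrow> expectation (avgs ks g) = expectation g"
  by (induction ks) (auto simp: expectation_avg bm_integrable bm_avgs)

lemma avgs_bounds:
  "set ks \<subseteq> I \<Longrightarrow> bm g \<Longrightarrow> (\<And>z. z \<in> space P \<Longrightarrow> c \<le> g z) \<Longrightarrow> x \<in> space P \<Longrightarrow> c \<le> avgs ks g x"
  by (induction ks arbitrary: x) (auto intro!: avg_bounds bm_avgs)

lemma avgs_all: "bm g \<Longrightarrow> x \<in> space P \<Longrightarrow> set ks = I \<Longrightarrow> avgs ks g x = expectation g"
  using indep_all_const[of "avgs ks g" x] indep_avgs_mem[of ks _ g] expectation_avgs[of ks g] by simp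

section \<open>Efron-Stein inequality and logarithmic Sobolev inequality\<close>

lemma expectation_diff_avg_sq:
  assumes g: "bm g" and i: "i \<in> I"
  shows "expectation (\<lambda>x. (g x - avg i g x)\<^sup>2) = expectation (\<lambda>x. (g x)\<^sup>2) - expectation (\<lambda>x. (avg i g x)\<^sup>2)"
proof -
  have "expectation (\<lambda>x. (g x - avg i g x)\<^sup>2) =
      expectation (\<lambda>x. (g x)\<^sup>2 - 2 * (avg i g x * g x) + (avg i g x)\<^sup>2)"
    by (intro Bochner_Integration.integral_cong) (auto simp: power2_eq_square algebra_simps)
  also have "\<dots> = expectation (\<lambda>x. (g x)\<^sup>2) - 2 * expectation (\<lambda>x. avg i g x * g x) + expectation (\<lambda>x. (avg i g x)\<^sup>2)"
    using g i by (simp add: bm_intros)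
  also have "expectation (\<lambda>x. avg i g x * g x) = expectation (\<lambda>x. (avg i g x)\<^sup>2)"
    using expectation_mult_avg[OF g g i] by (simp add: power2_eq_square)
  finally show ?thesis by simp
qed

text \<open>
  Averaging over one more coordinate \<open>k\<close> splits the error orthogonally into the fluctuation of \<open>g\<close>
  in \<open>k\<close> and the \<open>k\<close>-average of the previous error, and averaging contracts the \<open>L\<^sup>2\<close> norm.
\<close>

lemma efron_stein:
  assumes g: "bm g"
  shows "set ks \<subseteq> I \<Longrightarrow>
    expectation (\<lambda>x. (g x - avgs ks g x)\<^sup>2) \<le> (\<Sum>k\<leftarrow>ks. expectation (\<lambda>x. (g x - avg k g x)\<^sup>2))"
proof (induction ks)
  case (Cons k ks)
  then have k: "k \<in> I" and ks: "set ks \<subseteq> I" by auto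
  let ?h = "\<lambda>x. g x - avgs ks g x" and ?u = "\<lambda>x. g x - avg k g x"
  have h: "bm ?h" and u: "bm ?u" using g k ks by (auto intro: bm_intros)
  \<comment> \<open>averages over \<open>k\<close> are orthogonal to fluctuations in \<open>k\<close>\<close>
  have ortho: "expectation (\<lambda>x. avg k ?h x * ?u x) = 0"
  proof -
    have "expectation (\<lambda>x. avg k ?h x * ?u x) = expectation (\<lambda>x. avg k ?h x * avg k ?u x)"
      by (rule expectation_mult_avg[OF h u k])
    also have "\<dots> = expectation (\<lambda>_. 0)"
    proof (intro Bochner_Integration.integral_cong refl)
      fix x assume x: "x \<in> space P"
      have "avg k ?u x = 0"
        using avg_diff[OF g bm_avg[OF g k] k x] avg_of_indep[OF indep_avg_same[OF k] k x, of g] by simp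
      then show "avg k ?h x * avg k ?u x = 0" by simp
    qed
    finally show ?thesis by simp
  qed
  have "expectation (\<lambda>x. (g x - avgs (k # ks) g x)\<^sup>2)
      = expectation (\<lambda>x. (?u x)\<^sup>2 + 2 * (avg k ?h x * ?u x) + (avg k ?h x)\<^sup>2)"
  proof (intro Bochner_Integration.integral_cong refl)
    fix x assume x: "x \<in> space P"
    have "avg k ?h x = avg k g x - avgs (k # ks) g x"
      using avg_diff[OF g bm_avgs[OF g ks] k x] by simp
    then have "g x - avgs (k # ks) g x = ?u x + avg k ?h x" by simp
    then show "(g x - avgs (k # ks) g x)\<^sup>2 = (?u x)\<^sup>2 + 2 * (avg k ?h x * ?u x) + (avg k ?h x)\<^sup>2"
      by (simp only: power2_sum) (simp add: mult_ac)
  qed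
  also have "\<dots> = expectation (\<lambda>x. (?u x)\<^sup>2) + 2 * expectation (\<lambda>x. avg k ?h x * ?u x) + expectation (\<lambda>x. (avg k ?h x)\<^sup>2)"
  proof -
    have "integrable P (\<lambda>x. (?u x)\<^sup>2)" "integrable P (\<lambda>x. avg k ?h x * ?u x)" "integrable P (\<lambda>x. (avg k ?h x)\<^sup>2)"
      by (intro bm_intros h g k ks)+
    then show ?thesis by simp
  qed
  also have "\<dots> \<le> expectation (\<lambda>x. (?u x)\<^sup>2) + expectation (\<lambda>x. (?h x)\<^sup>2)"
  proof -
    have "0 \<le> expectation (\<lambda>x. (?h x - avg k ?h x)\<^sup>2)" by simp
    then show ?thesis using expectation_diff_avg_sq[OF h k] ortho by simp
  qed
  also have "\<dots> \<le> (\<Sum>k\<leftarrow>k # ks. expectation (\<lambda>x. (g x - avg k g x)\<^sup>2))"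
    using Cons.IH[OF ks] by simp
  finally show ?case .
qed simp

text \<open>
  Expanding the square expresses \<open>d\<^sub>i f\<close> through the averaging operator, which reduces all
  later integrals of \<open>d\<^sub>i f\<close> to the algebra of \<open>avg\<close>.
\<close>

lemma diff1_sq:
  assumes f: "bm f" and i: "i \<in> I" and x: "x \<in> space P"
  shows "2 * (diff1 M i f x)\<^sup>2 = (f x)\<^sup>2 - 2 * (f x * avg i f x) + avg i (\<lambda>x. (f x)\<^sup>2) x"
proof -
  interpret Mi: prob_space "M i" using i by (rule prob_factor)
  have int: "integrable (M i) (\<lambda>y. f (x(i := y)))" "integrable (M i) (\<lambda>y. (f (x(i := y)))\<^sup>2)"
    by (intro bm_intros Mi.bm_integrable bm_fiber f i x)+
  have "2 * (diff1 M i f x)\<^sup>2 = (\<integral>y. (f x - f (x(i := y)))\<^sup>2 \<partial>M i)"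
    by (simp add: diff1_def)
  also have "\<dots> = (\<integral>y. (f x)\<^sup>2 - 2 * f x * f (x(i := y)) + (f (x(i := y)))\<^sup>2 \<partial>M i)"
    by (intro Bochner_Integration.integral_cong) (auto simp: power2_eq_square algebra_simps)
  also have "\<dots> = (f x)\<^sup>2 - 2 * f x * avg i f x + avg i (\<lambda>x. (f x)\<^sup>2) x"
    using int by (simp add: avg_def Mi.prob_space)
  finally show ?thesis by simp
qed

lemma bm_diff1 [bm_intros]:
  assumes f: "bm f" and i: "i \<in> I" shows "bm (diff1 M i f)"
proof -
  have "bm (\<lambda>x. sqrt (1/2 * ((f x)\<^sup>2 - 2 * (f x * avg i f x) + avg i (\<lambda>x. (f x)\<^sup>2) x)))"
    by (intro bm_intros f i)
  then show ?thesis
  proof (rule bm_cong)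
    fix x assume x: "x \<in> space P"
    have "diff1 M i f x \<ge> 0" by (simp add: diff1_def)
    then show "sqrt (1/2 * ((f x)\<^sup>2 - 2 * (f x * avg i f x) + avg i (\<lambda>x. (f x)\<^sup>2) x)) = diff1 M i f x"
      by (simp flip: diff1_sq[OF f i x])
  qed
qed

lemma expectation_weighted_diff1_sq:
  assumes w: "bm w" and q: "bm q" and i: "i \<in> I"
  shows "2 * expectation (\<lambda>x. w x * (diff1 M i q x)\<^sup>2) =
    expectation (\<lambda>x. w x * (q x)\<^sup>2) - 2 * expectation (\<lambda>x. w x * q x * avg i q x)
      + expectation (\<lambda>x. w x * avg i (\<lambda>x. (q x)\<^sup>2) x)"
proof -
  have "2 * expectation (\<lambda>x. w x * (diff1 M i q x)\<^sup>2) = expectation (\<lambda>x. w x * (2 * (diff1 M i q x)\<^sup>2))"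
    by (subst integral_mult_right_zero[symmetric]) (simp add: mult_ac)
  also have "\<dots> = expectation (\<lambda>x. w x * (q x)\<^sup>2 - 2 * (w x * q x * avg i q x) + w x * avg i (\<lambda>x. (q x)\<^sup>2) x)"
    by (intro Bochner_Integration.integral_cong refl, subst diff1_sq[OF q i]) (auto simp: algebra_simps)
  also have "\<dots> = expectation (\<lambda>x. w x * (q x)\<^sup>2) - 2 * expectation (\<lambda>x. w x * q x * avg i q x)
      + expectation (\<lambda>x. w x * avg i (\<lambda>x. (q x)\<^sup>2) x)"
  proof -
    have "integrable P (\<lambda>x. w x * (q x)\<^sup>2)" "integrable P (\<lambda>x. w x * q x * avg i q x)"
      "integrable P (\<lambda>x. w x * avg i (\<lambda>x. (q x)\<^sup>2) x)"
      by (intro bm_intros w q i)+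
    then show ?thesis by simp
  qed
  finally show ?thesis .
qed

lemma expectation_diff1_sq:
  assumes f: "bm f" and i: "i \<in> I"
  shows "expectation (\<lambda>x. (diff1 M i f x)\<^sup>2) = expectation (\<lambda>x. (f x - avg i f x)\<^sup>2)"
proof -
  have "expectation (\<lambda>x. f x * avg i f x) = expectation (\<lambda>x. (avg i f x)\<^sup>2)"
    using expectation_mult_avg[OF f f i] by (simp add: power2_eq_square mult.commute)
  moreover have "expectation (avg i (\<lambda>x. (f x)\<^sup>2)) = expectation (\<lambda>x. (f x)\<^sup>2)"
    by (intro expectation_avg bm_intros f i)
  ultimately show ?thesis
    using expectation_weighted_diff1_sq[OF bm_const[of _ 1] f i] expectation_diff_avg_sq[OF f i] by simp
qed

text \<open>
  Integrate the pointwise hypothesis over a point and its resampled copy. Both sides are symmetric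
  in the two points, so by self-adjointness of \<open>avg i\<close> every term collapses onto one of them: the
  left becomes twice the covariance of \<open>exp g\<close> and \<open>g\<close> in coordinate \<open>i\<close>, the right four times the
  weighted energy. The free weight \<open>w\<close> and function \<open>q\<close> stand in for a chain rule, which the
  difference operator lacks.
\<close>

lemma coordinate_energy_bound:
  assumes g: "bm g" and w: "bm w" and q: "bm q" and i: "i \<in> I"
    and le: "\<And>x y. x \<in> space P \<Longrightarrow> y \<in> space P \<Longrightarrow>
      (exp (g x) - exp (g y)) * (g x - g y) \<le> (w x + w y) * (q x - q y)\<^sup>2"
  shows "expectation (\<lambda>x. exp (g x) * (g x - avg i g x)) \<le> 2 * expectation (\<lambda>x. w x * (diff1 M i q x)\<^sup>2)"
proof -
  interpret Mi: prob_space "M i" using i by (rule prob_factor)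
  let ?e = "\<lambda>x. exp (g x)"
  have e: "bm ?e" by (intro bm_intros g)
  \<comment> \<open>the two sides of the integrated hypothesis, multiplied out\<close>
  let ?L = "\<lambda>x. ?e x * g x - ?e x * avg i g x - avg i ?e x * g x + avg i (\<lambda>x. ?e x * g x) x"
  let ?R = "\<lambda>x. w x * (q x)\<^sup>2 - 2 * (w x * q x * avg i q x) + w x * avg i (\<lambda>x. (q x)\<^sup>2) x
      + avg i w x * (q x)\<^sup>2 - 2 * (avg i (\<lambda>x. w x * q x) x * q x) + avg i (\<lambda>x. w x * (q x)\<^sup>2) x"
  have "?L x \<le> ?R x" if x: "x \<in> space P" for x
  proof -
    let ?f = "\<lambda>y. x(i := y)"
    have "?L x = (\<integral>y. ?e x * g x - ?e x * g (?f y) - g x * ?e (?f y) + ?e (?f y) * g (?f y) \<partial>M i)"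
    proof -
      have "integrable (M i) (\<lambda>y. g (?f y))" "integrable (M i) (\<lambda>y. ?e (?f y))" "integrable (M i) (\<lambda>y. ?e (?f y) * g (?f y))"
        by (intro Mi.bm_integrable bm_intros bm_fiber g i x)+
      then show ?thesis by (simp add: avg_def Mi.prob_space)
    qed
    also have "\<dots> = (\<integral>y. (?e x - ?e (?f y)) * (g x - g (?f y)) \<partial>M i)"
      by (intro Bochner_Integration.integral_cong) (auto simp: algebra_simps)
    also have "\<dots> \<le> (\<integral>y. (w x + w (?f y)) * (q x - q (?f y))\<^sup>2 \<partial>M i)"
      by (intro integral_mono le upd_space i x Mi.bm_integrable bm_intros bm_fiber g w q)
    also have "\<dots> = (\<integral>y. w x * (q x)\<^sup>2 - 2 * (w x * q x) * q (?f y) + w x * (q (?f y))\<^sup>2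
        + (q x)\<^sup>2 * w (?f y) - 2 * q x * (w (?f y) * q (?f y)) + w (?f y) * (q (?f y))\<^sup>2 \<partial>M i)"
      by (intro Bochner_Integration.integral_cong) (auto simp: power2_eq_square algebra_simps)
    also have "\<dots> = ?R x"
    proof -
      have "integrable (M i) (\<lambda>y. q (?f y))" "integrable (M i) (\<lambda>y. (q (?f y))\<^sup>2)" "integrable (M i) (\<lambda>y. w (?f y))"
        "integrable (M i) (\<lambda>y. w (?f y) * q (?f y))" "integrable (M i) (\<lambda>y. w (?f y) * (q (?f y))\<^sup>2)"
        by (intro Mi.bm_integrable bm_intros bm_fiber w q i x)+
      then show ?thesis by (simp add: avg_def Mi.prob_space)
    qed
    finally show ?thesis .
  qed
  then have "expectation ?L \<le> expectation ?R"
    by (intro integral_mono bm_intros g w q i) auto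
  moreover have "expectation ?L = 2 * expectation (\<lambda>x. exp (g x) * (g x - avg i g x))"
  proof -
    have int: "integrable P (\<lambda>x. ?e x * g x)" "integrable P (\<lambda>x. ?e x * avg i g x)" "integrable P (\<lambda>x. avg i ?e x * g x)"
      "integrable P (avg i (\<lambda>x. ?e x * g x))"
      by (intro bm_intros g i)+
    have "expectation (avg i (\<lambda>x. ?e x * g x)) = expectation (\<lambda>x. ?e x * g x)"
      by (intro expectation_avg int i)
    then show ?thesis using int avg_selfadjoint[OF e g i] by (simp add: right_diff_distrib)
  qed
  moreover have "expectation ?R = 2 * (2 * expectation (\<lambda>x. w x * (diff1 M i q x)\<^sup>2))"
  proof -
    have int: "integrable P (\<lambda>x. w x * (q x)\<^sup>2)" "integrable P (\<lambda>x. w x * q x * avg i q x)"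
      "integrable P (\<lambda>x. w x * avg i (\<lambda>x. (q x)\<^sup>2) x)" "integrable P (\<lambda>x. avg i w x * (q x)\<^sup>2)"
      "integrable P (\<lambda>x. avg i (\<lambda>x. w x * q x) x * q x)" "integrable P (avg i (\<lambda>x. w x * (q x)\<^sup>2))"
      by (intro bm_intros w q i)+
    have 1: "expectation (avg i (\<lambda>x. w x * (q x)\<^sup>2)) = expectation (\<lambda>x. w x * (q x)\<^sup>2)"
      by (intro expectation_avg int i)
    have 2: "expectation (\<lambda>x. avg i w x * (q x)\<^sup>2) = expectation (\<lambda>x. w x * avg i (\<lambda>x. (q x)\<^sup>2) x)"
      by (intro avg_selfadjoint bm_intros w q i)
    have 3: "expectation (\<lambda>x. avg i (\<lambda>x. w x * q x) x * q x) = expectation (\<lambda>x. w x * q x * avg i q x)"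
      by (intro avg_selfadjoint bm_intros w q i)
    show ?thesis using int unfolding expectation_weighted_diff1_sq[OF w q i] by (simp add: 1 2 3)
  qed
  ultimately show ?thesis by simp
qed

lemma avg_le_ln_avg_exp:
  assumes g: "bm g" and i: "i \<in> I" and x: "x \<in> space P"
  shows "avg i g x \<le> ln (avg i (\<lambda>x. exp (g x)) x)"
proof -
  interpret Mi: prob_space "M i" using i by (rule prob_factor)
  let ?a = "avg i g x"
  have "exp ?a = (\<integral>y. exp ?a * (1 + (g (x(i := y)) - ?a)) \<partial>M i)"
    using fiber_integrable[OF g i x] by (simp add: avg_def Mi.prob_space)
  also have "\<dots> \<le> (\<integral>y. exp (g (x(i := y))) \<partial>M i)"
  proof (intro integral_mono Mi.bm_integrable bm_intros bm_fiber g i x)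
    fix y
    have "exp ?a * (1 + (g (x(i := y)) - ?a)) \<le> exp ?a * exp (g (x(i := y)) - ?a)"
      by (intro mult_left_mono exp_ge_add_one_self) simp
    then show "exp ?a * (1 + (g (x(i := y)) - ?a)) \<le> exp (g (x(i := y)))" by (simp flip: exp_add)
  qed
  finally have "exp ?a \<le> avg i (\<lambda>x. exp (g x)) x" by (simp add: avg_def)
  then show ?thesis using exp_gt_zero[of ?a] by (subst ln_ge_iff) linarith+
qed

text \<open>
  The entropy of \<open>exp g\<close> in coordinate \<open>i\<close> is the maximum over positive \<open>\<psi>\<close> of the left-hand side
  (attained at \<open>\<psi> = exp g\<close>), by \<open>log_ratio_le\<close>; and it is at most the covariance on the right, since
  \<open>avg i g \<le> ln (avg i (exp g))\<close> by Jensen's inequality.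
\<close>

lemma avg_ln_ratio_le:
  assumes g: "bm g" and \<psi>: "bm \<psi>" and c: "c > 0" "\<And>x. x \<in> space P \<Longrightarrow> c \<le> \<psi> x" and i: "i \<in> I"
  shows "expectation (\<lambda>x. exp (g x) * (ln (\<psi> x) - ln (avg i \<psi> x)))
    \<le> expectation (\<lambda>x. exp (g x) * (g x - avg i g x))"
proof -
  let ?e = "\<lambda>x. exp (g x)"
  obtain C where C: "\<And>x. x \<in> space P \<Longrightarrow> \<bar>g x\<bar> \<le> C" using bounded_measurable_bound[OF g] by metis
  have e: "bm ?e" by (intro bm_intros g)
  have lowe: "exp (-C) \<le> ?e x" if "x \<in> space P" for x using C[OF that] by auto
  have low\<psi>: "c \<le> avg i \<psi> x" if "x \<in> space P" for x by (intro avg_bounds \<psi> i that c)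
  have lowae: "exp (-C) \<le> avg i ?e x" if "x \<in> space P" for x by (intro avg_bounds e i that lowe)
  have b1: "bm (\<lambda>x. ln (\<psi> x))" "bm (\<lambda>x. ln (avg i \<psi> x))"
    using bm_lower_ln[OF \<psi> c] bm_lower_ln[OF bm_avg[OF \<psi> i] c(1) low\<psi>] by auto
  have b3: "bm (\<lambda>x. ln (avg i ?e x))"
    by (rule bm_lower_ln[of _ _ "exp (-C)"]; intro bm_avg i lowae e exp_gt_zero)
  have b2: "bm (\<lambda>x. avg i ?e x / avg i \<psi> x)"
    by (rule bm_lower_divide[OF _ _ c(1)]; intro bm_avg \<psi> e i low\<psi>)
  have "expectation (\<lambda>x. exp (g x) * (ln (\<psi> x) - ln (avg i \<psi> x) - g x + ln (avg i ?e x)))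
      \<le> expectation (\<lambda>x. \<psi> x * (avg i ?e x / avg i \<psi> x) - exp (g x))"
  proof (intro integral_mono bm_intros b1 b2 b3 g \<psi>)
    fix x assume x: "x \<in> space P"
    have "\<psi> x > 0" "avg i \<psi> x > 0" "avg i ?e x > 0"
      using c(1) c(2)[OF x] low\<psi>[OF x] lowae[OF x] exp_gt_zero[of "-C"] by linarith+
    then show "exp (g x) * (ln (\<psi> x) - ln (avg i \<psi> x) - g x + ln (avg i ?e x)) \<le> \<psi> x * (avg i ?e x / avg i \<psi> x) - exp (g x)"
      using log_ratio_le[of "avg i ?e x" "avg i \<psi> x" "g x" "ln (\<psi> x)"] by simp
  qed
  also have "\<dots> = expectation (\<lambda>x. \<psi> x * (avg i ?e x / avg i \<psi> x)) - expectation ?e"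
    by (intro Bochner_Integration.integral_diff bm_intros \<psi> b2 g)
  also have "expectation (\<lambda>x. \<psi> x * (avg i ?e x / avg i \<psi> x)) = expectation (avg i (\<lambda>x. (avg i ?e x / avg i \<psi> x) * \<psi> x))"
    by (subst expectation_avg[OF i]) (intro bm_intros \<psi> b2, simp only: mult.commute)
  also have "\<dots> = expectation (avg i ?e)"
  proof (intro Bochner_Integration.integral_cong refl)
    fix x assume x: "x \<in> space P"
    have "indep_coord i (\<lambda>x. avg i ?e x / avg i \<psi> x)"
      using indep_avg_same[OF i] by (simp add: indep_coord_def)
    then have "avg i (\<lambda>x. (avg i ?e x / avg i \<psi> x) * \<psi> x) x = (avg i ?e x / avg i \<psi> x) * avg i \<psi> x"
      by (rule avg_mult_indep[OF _ i x])
    then show "avg i (\<lambda>x. (avg i ?e x / avg i \<psi> x) * \<psi> x) x = avg i ?e x"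
      using low\<psi>[OF x] c(1) by simp
  qed
  also have "\<dots> = expectation ?e" by (intro expectation_avg bm_intros g i)
  finally have "expectation (\<lambda>x. exp (g x) * (ln (\<psi> x) - ln (avg i \<psi> x) - g x + ln (avg i ?e x))) \<le> 0" by simp
  also have "(\<lambda>x. exp (g x) * (ln (\<psi> x) - ln (avg i \<psi> x) - g x + ln (avg i ?e x))) =
      (\<lambda>x. exp (g x) * (ln (\<psi> x) - ln (avg i \<psi> x)) - exp (g x) * (g x - ln (avg i ?e x)))"
    by (auto simp: algebra_simps)
  finally have "expectation (\<lambda>x. exp (g x) * (ln (\<psi> x) - ln (avg i \<psi> x))) \<le> expectation (\<lambda>x. exp (g x) * (g x - ln (avg i ?e x)))"
    by (subst (asm) Bochner_Integration.integral_diff) (auto intro!: bm_integrable bm_mult bm_diff b1 b3 e g)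
  also have "\<dots> \<le> expectation (\<lambda>x. exp (g x) * (g x - avg i g x))"
    by (intro integral_mono bm_integrable bm_mult bm_diff b1 b3 e g bm_avg i mult_left_mono diff_left_mono avg_le_ln_avg_exp) auto
  finally show ?thesis .
qed

text \<open>
  Subadditivity of entropy. Peeling off coordinate \<open>k\<close> adds the term \<open>ln (\<psi> / avg k \<psi>)\<close> with \<open>\<psi>\<close>
  the average over the coordinates peeled off before, and \<open>avg_ln_ratio_le\<close> removes the dependence
  on \<open>\<psi>\<close>.
\<close>

lemma entropy_tensorization:
  assumes g: "bm g"
  shows "set ks \<subseteq> I \<Longrightarrow>
    expectation (\<lambda>x. exp (g x) * (g x - ln (avgs ks (\<lambda>x. exp (g x)) x)))
      \<le> (\<Sum>k\<leftarrow>ks. expectation (\<lambda>x. exp (g x) * (g x - avg k g x)))"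
proof (induction ks)
  case (Cons k ks)
  then have k: "k \<in> I" and ks: "set ks \<subseteq> I" by auto
  let ?e = "\<lambda>x. exp (g x)" and ?\<psi> = "avgs ks (\<lambda>x. exp (g x))"
  obtain C where C: "\<And>x. x \<in> space P \<Longrightarrow> \<bar>g x\<bar> \<le> C" using bounded_measurable_bound[OF g] by metis
  have e: "bm ?e" by (intro bm_intros g)
  have lowe: "exp (-C) \<le> ?e x" if "x \<in> space P" for x using C[OF that] by auto
  have low: "exp (-C) \<le> ?\<psi> x" if "x \<in> space P" for x by (intro avgs_bounds e ks that lowe)
  have b: "bm (\<lambda>x. ln (?\<psi> x))"
    by (rule bm_lower_ln[of _ _ "exp (-C)"]) (auto intro!: bm_avgs e ks low)
  have b': "bm (\<lambda>x. ln (avg k ?\<psi> x))"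
    by (rule bm_lower_ln[of _ _ "exp (-C)"]) (auto intro!: bm_avg bm_avgs e k ks avg_bounds low)
  have "expectation (\<lambda>x. ?e x * (g x - ln (avg k ?\<psi> x))) =
      expectation (\<lambda>x. ?e x * (ln (?\<psi> x) - ln (avg k ?\<psi> x)) + ?e x * (g x - ln (?\<psi> x)))"
    by (intro Bochner_Integration.integral_cong) (auto simp: algebra_simps)
  also have "\<dots> = expectation (\<lambda>x. ?e x * (ln (?\<psi> x) - ln (avg k ?\<psi> x))) + expectation (\<lambda>x. ?e x * (g x - ln (?\<psi> x)))"
    by (intro Bochner_Integration.integral_add bm_integrable bm_mult bm_diff b b' e g)
  also have "\<dots> \<le> expectation (\<lambda>x. ?e x * (g x - avg k g x)) + (\<Sum>k\<leftarrow>ks. expectation (\<lambda>x. ?e x * (g x - avg k g x)))"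
    by (intro add_mono Cons.IH ks avg_ln_ratio_le[of _ _ "exp (-C)"] g bm_avgs e low k exp_gt_zero)
  finally show ?case by simp
qed (simp)

text \<open>
  The hypothesis is the two-point form of a gradient estimate. It is used with \<open>q = f\<close> and
  \<open>g = t f\<close>, and with \<open>q = u\<close> and \<open>g = t u\<^sup>2\<close>.
\<close>

lemma modified_log_sobolev:
  assumes g: "bm g" and w: "bm w" and q: "bm q"
    and le: "\<And>x y. x \<in> space P \<Longrightarrow> y \<in> space P \<Longrightarrow>
      (exp (g x) - exp (g y)) * (g x - g y) \<le> (w x + w y) * (q x - q y)\<^sup>2"
  shows "expectation (\<lambda>x. g x * exp (g x)) - expectation (\<lambda>x. exp (g x)) * ln (expectation (\<lambda>x. exp (g x)))
    \<le> 2 * expectation (\<lambda>x. w x * (\<Sum>i\<in>I. (diff1 M i q x)\<^sup>2))"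
proof -
  let ?e = "\<lambda>x. exp (g x)"
  obtain ks where ks: "set ks = I" "distinct ks" using finite_distinct_list[OF finite_index] by blast
  have e: "bm ?e" by (intro bm_intros g)
  have "expectation (\<lambda>x. g x * ?e x) - expectation ?e * ln (expectation ?e)
      = expectation (\<lambda>x. ?e x * (g x - ln (expectation ?e)))"
  proof -
    have "integrable P (\<lambda>x. g x * ?e x)" "integrable P ?e" by (intro bm_intros g)+
    then show ?thesis by (simp add: right_diff_distrib mult.commute[of "exp _"])
  qed
  also have "\<dots> = expectation (\<lambda>x. ?e x * (g x - ln (avgs ks ?e x)))"
    by (intro Bochner_Integration.integral_cong) (auto simp: avgs_all[OF e _ ks(1)])
  also have "\<dots> \<le> (\<Sum>k\<leftarrow>ks. expectation (\<lambda>x. ?e x * (g x - avg k g x)))"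
    using ks by (intro entropy_tensorization g) auto
  also have "\<dots> = (\<Sum>k\<in>I. expectation (\<lambda>x. ?e x * (g x - avg k g x)))"
    using ks by (simp add: sum_list_distinct_conv_sum_set)
  also have "\<dots> \<le> (\<Sum>k\<in>I. 2 * expectation (\<lambda>x. w x * (diff1 M k q x)\<^sup>2))"
    by (intro sum_mono coordinate_energy_bound g w q le)
  also have "\<dots> = 2 * expectation (\<lambda>x. w x * (\<Sum>k\<in>I. (diff1 M k q x)\<^sup>2))"
  proof -
    have "integrable P (\<lambda>x. w x * (diff1 M k q x)\<^sup>2)" if "k \<in> I" for k
      by (intro bm_intros w q that)
    then show ?thesis by (simp add: sum_distrib_left)
  qed
  finally show ?thesis .
qed

end

section \<open>Exponential moments under bounded second differences\<close>

text \<open>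
  The trapezoidal rule overestimates the integral of the convex function \<open>exp\<close> between \<open>b\<close> and \<open>a\<close>.
\<close>

lemma exp_difference_trapezoid:
  fixes a b :: real
  shows "(exp a - exp b) * (a - b) \<le> (exp a + exp b) / 2 * (a - b)\<^sup>2"
proof -
  have *: "exp d - 1 \<le> (exp d + 1) / 2 * d" if "d \<ge> 0" for d :: real
  proof -
    let ?F = "\<lambda>d::real. (exp d + 1) / 2 * d - exp d + 1"
    have "?F 0 \<le> ?F d"
    proof (rule DERIV_nonneg_imp_nondecreasing[OF that])
      fix x :: real assume "0 \<le> x" "x \<le> d"
      have "exp x * (1 - x) \<le> exp x * exp (- x)"
        using exp_ge_add_one_self[of "-x"] by (intro mult_left_mono) auto
      then have "0 \<le> (1 + exp x * x - exp x) / 2" by (simp add: exp_minus algebra_simps)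
      moreover have "(?F has_real_derivative (1 + exp x * x - exp x) / 2) (at x)"
        by (auto intro!: derivative_eq_intros simp: field_simps)
      ultimately show "\<exists>y. (?F has_real_derivative y) (at x) \<and> 0 \<le> y" by blast
    qed
    then show ?thesis by simp
  qed
  have le: "(exp a - exp b) * (a - b) \<le> (exp a + exp b) / 2 * (a - b)\<^sup>2" if "b \<le> a" for a b :: real
  proof -
    have "(exp a - exp b) * (a - b) = exp b * (exp (a - b) - 1) * (a - b)" by (simp add: exp_diff field_simps)
    also have "\<dots> \<le> exp b * ((exp (a - b) + 1) / 2 * (a - b)) * (a - b)"
      using *[of "a - b"] that by (intro mult_right_mono mult_left_mono) auto
    also have "\<dots> = (exp a + exp b) / 2 * (a - b)\<^sup>2" by (simp add: exp_diff power2_eq_square field_simps)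
    finally show ?thesis .
  qed
  show ?thesis
  proof (cases "b \<le> a")
    case False
    then show ?thesis using le[of a b] by (simp add: algebra_simps power2_commute)
  qed (rule le)
qed

text \<open>
  The term of the larger of the two numbers suffices on the right: for \<open>a \<ge> b\<close> one has
  \<open>a\<^sup>2 - b\<^sup>2 \<le> 2 a (a - b)\<close>, which takes the place of the chain rule for the square.
\<close>

lemma exp_square_difference:
  fixes a b t :: real
  assumes ab: "a \<ge> 0" "b \<ge> 0" and t: "t \<ge> 0"
  shows "(exp (t * a\<^sup>2) - exp (t * b\<^sup>2)) * (t * a\<^sup>2 - t * b\<^sup>2)
    \<le> (4 * t\<^sup>2 * a\<^sup>2 * exp (t * a\<^sup>2) + 4 * t\<^sup>2 * b\<^sup>2 * exp (t * b\<^sup>2)) * (a - b)\<^sup>2"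
proof -
  have le: "(exp (t * a\<^sup>2) - exp (t * b\<^sup>2)) * (t * a\<^sup>2 - t * b\<^sup>2) \<le> 4 * t\<^sup>2 * a\<^sup>2 * exp (t * a\<^sup>2) * (a - b)\<^sup>2"
    if "0 \<le> b" "b \<le> a" for a b :: real
  proof -
    let ?d = "t * a\<^sup>2 - t * b\<^sup>2"
    have sq: "b\<^sup>2 \<le> a\<^sup>2" using that by (intro power_mono)
    then have d: "?d \<ge> 0" using t by (simp add: mult_left_mono)
    have "exp (t * a\<^sup>2) - exp (t * b\<^sup>2) = exp (t * a\<^sup>2) * (1 - exp (- ?d))"
      by (simp add: right_diff_distrib flip: exp_add)
    also have "\<dots> \<le> exp (t * a\<^sup>2) * ?d"
    proof (rule mult_left_mono)
      show "1 - exp (- ?d) \<le> ?d" using exp_ge_add_one_self[of "- ?d"] by linarith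
    qed simp
    finally have "(exp (t * a\<^sup>2) - exp (t * b\<^sup>2)) * ?d \<le> exp (t * a\<^sup>2) * ?d * ?d"
      using d by (rule mult_right_mono)
    also have "\<dots> = exp (t * a\<^sup>2) * t\<^sup>2 * (a - b)\<^sup>2 * (a + b)\<^sup>2"
      by (simp add: power2_eq_square algebra_simps)
    also have "\<dots> \<le> exp (t * a\<^sup>2) * t\<^sup>2 * (a - b)\<^sup>2 * (2 * a)\<^sup>2"
      using that by (intro mult_left_mono power_mono) auto
    finally show ?thesis by (simp add: power_mult_distrib mult_ac)
  qed
  show ?thesis
  proof (cases "b \<le> a")
    case True
    have "0 \<le> 4 * t\<^sup>2 * b\<^sup>2 * exp (t * b\<^sup>2) * (a - b)\<^sup>2" by simp
    then show ?thesis using le[OF ab(2) True] by (simp only: distrib_right)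
  next
    case False
    have "0 \<le> 4 * t\<^sup>2 * a\<^sup>2 * exp (t * a\<^sup>2) * (a - b)\<^sup>2" by simp
    moreover have "(exp (t * a\<^sup>2) - exp (t * b\<^sup>2)) * (t * a\<^sup>2 - t * b\<^sup>2) = (exp (t * b\<^sup>2) - exp (t * a\<^sup>2)) * (t * b\<^sup>2 - t * a\<^sup>2)"
      by (simp add: algebra_simps)
    ultimately show ?thesis using le[OF ab(1), of b] False unfolding distrib_right power2_commute[of a b] by linarith
  qed
qed

context finite_product_prob
begin

text \<open>
  With \<open>|du| \<le> 1\<close> the energy of \<open>t u\<^sup>2\<close> is at most \<open>8 t\<^sup>2 E (u\<^sup>2 exp (t u\<^sup>2))\<close>, which is the
  self-bounding situation with \<open>\<kappa> = 8\<close> for the variable \<open>u\<^sup>2\<close>.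
\<close>

lemma square_exponential_moment:
  assumes u: "bm u" "\<And>x. x \<in> space P \<Longrightarrow> u x \<ge> 0"
    and grad: "AE x in P. (\<Sum>i\<in>I. (diff1 M i u x)\<^sup>2) \<le> 1"
    and c: "c > 0" "8 * c < 1"
  shows "ln (expectation (\<lambda>x. exp (c * (u x)\<^sup>2))) \<le> c * expectation (\<lambda>x. (u x)\<^sup>2) / (1 - 8 * c)"
proof (rule herbst_self_bounding)
  show "bm (\<lambda>x. (u x)\<^sup>2)" by (intro bm_intros u)
  show "c > 0" "8 * c < 1" by fact+
  fix t :: real assume t: "0 < t" "t \<le> c"
  let ?w = "\<lambda>x. 4 * t\<^sup>2 * (u x)\<^sup>2 * exp (t * (u x)\<^sup>2)" and ?W = "\<lambda>x. \<Sum>i\<in>I. (diff1 M i u x)\<^sup>2"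
  have int: "integrable P (\<lambda>x. (u x)\<^sup>2 * exp (t * (u x)\<^sup>2))" by (intro bm_intros u)
  have "t * expectation (\<lambda>x. (u x)\<^sup>2 * exp (t * (u x)\<^sup>2)) - mgf (\<lambda>x. (u x)\<^sup>2) t * ln (mgf (\<lambda>x. (u x)\<^sup>2) t)
    = expectation (\<lambda>x. t * (u x)\<^sup>2 * exp (t * (u x)\<^sup>2)) - mgf (\<lambda>x. (u x)\<^sup>2) t * ln (mgf (\<lambda>x. (u x)\<^sup>2) t)"
    by (simp add: mult.assoc)
  also have "\<dots> \<le> 2 * expectation (\<lambda>x. ?w x * ?W x)"
    by (intro modified_log_sobolev bm_intros u exp_square_difference) (use t in auto)
  also have "\<dots> \<le> 2 * expectation ?w"
  proof -
    have "AE x in P. ?w x * ?W x \<le> ?w x"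
      using grad by eventually_elim (intro mult_left_le, auto)
    then have "expectation (\<lambda>x. ?w x * ?W x) \<le> expectation ?w"
      by (intro integral_mono_AE bm_intros u)
    then show ?thesis by simp
  qed
  also have "\<dots> = 8 * t\<^sup>2 * expectation (\<lambda>x. (u x)\<^sup>2 * exp (t * (u x)\<^sup>2))"
    by (simp add: mult.assoc)
  finally show "t * expectation (\<lambda>x. (u x)\<^sup>2 * exp (t * (u x)\<^sup>2)) - mgf (\<lambda>x. (u x)\<^sup>2) t * ln (mgf (\<lambda>x. (u x)\<^sup>2) t)
    \<le> 8 * t\<^sup>2 * expectation (\<lambda>x. (u x)\<^sup>2 * exp (t * (u x)\<^sup>2))" .
qed

text \<open>
  The logarithmic Sobolev inequality bounds the entropy of \<open>exp (t f)\<close> by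
  \<open>t\<^sup>2 E (|df|\<^sup>2 exp (t f))\<close>, and entropy duality bounds \<open>2 s\<^sup>2 E (|df|\<^sup>2 exp (t f))\<close> by the same
  entropy plus a multiple of \<open>log E exp (2 s\<^sup>2 |df|\<^sup>2)\<close>. Because \<open>t\<^sup>2 \<le> s\<^sup>2\<close>, the entropy
  on the right carries a factor at most \<open>1/2\<close> and can be absorbed.
\<close>

lemma log_mgf_le_gradient:
  assumes f: "bm f" and f0: "expectation f = 0" and s: "s > 0"
  shows "ln (mgf f s) \<le> ln (expectation (\<lambda>x. exp (2 * s\<^sup>2 * (\<Sum>i\<in>I. (diff1 M i f x)\<^sup>2))))"
proof -
  let ?W = "\<lambda>x. \<Sum>i\<in>I. (diff1 M i f x)\<^sup>2"
  have W: "bm ?W" by (intro bm_intros f)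
  have W0: "?W x \<ge> 0" for x by (simp add: sum_nonneg)
  define \<psi> where "\<psi> = ln (expectation (\<lambda>x. exp (2 * s\<^sup>2 * ?W x)))"
  have "1 \<le> expectation (\<lambda>x. exp (2 * s\<^sup>2 * ?W x))"
    by (intro integral_ge_const bm_intros f) (auto simp: W0)
  then have \<psi>: "\<psi> \<ge> 0" by (simp add: \<psi>_def)
  have "ln (mgf f s) \<le> s * expectation f + \<psi> / s\<^sup>2 * s\<^sup>2"
  proof (rule herbst_constant_energy[OF f s])
    fix t assume t: "0 < t" "t \<le> s"
    let ?e = "\<lambda>x. exp (t * f x)"
    define Z where "Z = mgf f t"
    have Z: "Z > 0" unfolding Z_def by (rule mgf_pos[OF f])
    define Ent where "Ent = t * expectation (\<lambda>x. f x * ?e x) - Z * ln Z"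
    have Ent: "Ent = expectation (\<lambda>x. t * f x * ?e x) - expectation ?e * ln (expectation ?e)"
      by (simp add: Ent_def Z_def mult.assoc)
    have "Ent \<le> 2 * expectation (\<lambda>x. t\<^sup>2 / 2 * ?e x * ?W x)"
      unfolding Ent
    proof (intro modified_log_sobolev bm_intros f)
      fix x y
      show "(exp (t * f x) - exp (t * f y)) * (t * f x - t * f y)
          \<le> (t\<^sup>2 / 2 * exp (t * f x) + t\<^sup>2 / 2 * exp (t * f y)) * (f x - f y)\<^sup>2"
      proof -
        have "(t * f x - t * f y)\<^sup>2 = t\<^sup>2 * (f x - f y)\<^sup>2"
          by (metis power_mult_distrib right_diff_distrib)
        then have "(exp (t * f x) + exp (t * f y)) / 2 * (t * f x - t * f y)\<^sup>2
            = (t\<^sup>2 / 2 * exp (t * f x) + t\<^sup>2 / 2 * exp (t * f y)) * (f x - f y)\<^sup>2"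
          by (simp add: field_simps)
        then show ?thesis using exp_difference_trapezoid[of "t * f x" "t * f y"] by simp
      qed
    qed
    also have "\<dots> = t\<^sup>2 * expectation (\<lambda>x. ?W x * ?e x)"
      by (simp add: mult.assoc mult.commute[of "?W _"])
    finally have 1: "Ent \<le> t\<^sup>2 * expectation (\<lambda>x. ?W x * ?e x)" .
    have "expectation (\<lambda>x. 2 * s\<^sup>2 * ?W x * ?e x) \<le> Ent + Z * \<psi>"
      unfolding Ent Z_def \<psi>_def by (intro entropy_duality bm_intros f)
    then have 2: "2 * s\<^sup>2 * expectation (\<lambda>x. ?W x * ?e x) \<le> Ent + Z * \<psi>"
      by (simp add: mult.assoc)
    have ts: "t\<^sup>2 \<le> s\<^sup>2" using t by (intro power_mono) auto
    have "2 * s\<^sup>2 * Ent \<le> t\<^sup>2 * (2 * s\<^sup>2 * expectation (\<lambda>x. ?W x * ?e x))"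
      using mult_left_mono[OF 1, of "2 * s\<^sup>2"] by (simp add: mult_ac)
    also have "\<dots> \<le> t\<^sup>2 * (Ent + Z * \<psi>)" using 2 by (intro mult_left_mono) auto
    finally have 3: "(2 * s\<^sup>2 - t\<^sup>2) * Ent \<le> t\<^sup>2 * Z * \<psi>" by (simp add: algebra_simps)
    have "s\<^sup>2 * Ent \<le> t\<^sup>2 * Z * \<psi>"
    proof (cases "Ent \<ge> 0")
      case True
      have "s\<^sup>2 * Ent \<le> (2 * s\<^sup>2 - t\<^sup>2) * Ent" using ts True by (intro mult_right_mono) auto
      then show ?thesis using 3 by linarith
    next
      case False
      then have "s\<^sup>2 * Ent \<le> 0" by (simp add: mult_nonneg_nonpos)
      also have "0 \<le> t\<^sup>2 * Z * \<psi>" using Z \<psi> by simp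
      finally show ?thesis .
    qed
    then have "Ent \<le> \<psi> / s\<^sup>2 * t\<^sup>2 * Z" using s by (simp add: field_simps)
    then show "t * expectation (\<lambda>x. f x * ?e x) - mgf f t * ln (mgf f t) \<le> \<psi> / s\<^sup>2 * t\<^sup>2 * mgf f t"
      by (simp add: Ent_def Z_def)
  qed
  then show ?thesis using s f0 by (simp add: \<psi>_def)
qed

text \<open>
  The restriction \<open>s \<le> 1/8\<close> keeps the factor \<open>4 s\<^sup>2\<close> of \<open>u\<^sup>2\<close> in the exponent at most \<open>1/16\<close>,
  half of the critical value \<open>1/8\<close> of \<open>square_exponential_moment\<close>.
\<close>

lemma mgf_second_order_bound:
  assumes f: "bm f" and f0: "expectation f = 0"
    and u: "bm u" "\<And>x. x \<in> space P \<Longrightarrow> u x \<ge> 0"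
    and fu: "AE x in P. (\<Sum>i\<in>I. (diff1 M i f x)\<^sup>2) \<le> 2 * b0\<^sup>2 + 2 * (u x)\<^sup>2"
    and grad: "AE x in P. (\<Sum>i\<in>I. (diff1 M i u x)\<^sup>2) \<le> 1"
    and ub: "expectation (\<lambda>x. (u x)\<^sup>2) \<le> b\<^sup>2"
    and s: "0 < s" "s \<le> 1 / 8"
  shows "ln (mgf f s) \<le> 4 * s\<^sup>2 * b0\<^sup>2 + 8 * s\<^sup>2 * b\<^sup>2"
proof -
  let ?W = "\<lambda>x. \<Sum>i\<in>I. (diff1 M i f x)\<^sup>2"
  have s2: "s\<^sup>2 \<le> 1 / 64" using power_mono[OF s(2), of 2] s(1) by (simp add: power_divide)
  have pos: "0 < expectation (\<lambda>x. exp (4 * s\<^sup>2 * (u x)\<^sup>2))"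
    using mgf_pos[of "\<lambda>x. (u x)\<^sup>2" "4 * s\<^sup>2"] u by (simp add: bm_intros)
  have W: "bm ?W" by (intro bm_intros f)
  have le: "expectation (\<lambda>x. exp (2 * s\<^sup>2 * ?W x)) \<le> expectation (\<lambda>x. exp (4 * s\<^sup>2 * b0\<^sup>2) * exp (4 * s\<^sup>2 * (u x)\<^sup>2))"
  proof (intro integral_mono_AE bm_intros f u)
    show "AE x in P. exp (2 * s\<^sup>2 * ?W x) \<le> exp (4 * s\<^sup>2 * b0\<^sup>2) * exp (4 * s\<^sup>2 * (u x)\<^sup>2)"
      using fu
    proof eventually_elim
      case (elim x)
      have "2 * s\<^sup>2 * ?W x \<le> 2 * s\<^sup>2 * (2 * b0\<^sup>2 + 2 * (u x)\<^sup>2)" using elim by (intro mult_left_mono) auto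
      then show ?case by (simp flip: exp_add add: algebra_simps)
    qed
  qed
  have "ln (mgf f s) \<le> ln (expectation (\<lambda>x. exp (2 * s\<^sup>2 * ?W x)))"
    by (rule log_mgf_le_gradient[OF f f0 s(1)])
  also have "\<dots> \<le> ln (expectation (\<lambda>x. exp (4 * s\<^sup>2 * b0\<^sup>2) * exp (4 * s\<^sup>2 * (u x)\<^sup>2)))"
    using mgf_pos[OF W, of "2 * s\<^sup>2"] le by (intro ln_mono) auto
  also have "\<dots> = 4 * s\<^sup>2 * b0\<^sup>2 + ln (expectation (\<lambda>x. exp (4 * s\<^sup>2 * (u x)\<^sup>2)))"
    using pos by (simp add: ln_mult)
  also have "ln (expectation (\<lambda>x. exp (4 * s\<^sup>2 * (u x)\<^sup>2))) \<le> 4 * s\<^sup>2 * expectation (\<lambda>x. (u x)\<^sup>2) / (1 - 8 * (4 * s\<^sup>2))"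
    using s s2 by (intro square_exponential_moment u grad) auto
  also have "\<dots> \<le> 4 * s\<^sup>2 * b\<^sup>2 / (1 / 2)"
    using ub s2 by (intro frac_le mult_left_mono) auto
  finally show ?thesis by simp
qed

lemma diff1_uminus: "diff1 M i (\<lambda>x. - f x) = diff1 M i f"
proof -
  have "(- a - - b)\<^sup>2 = (a - b)\<^sup>2" for a b :: real by (simp add: power2_eq_square algebra_simps)
  then show ?thesis by (simp add: diff1_def fun_eq_iff)
qed

text \<open>
  With \<open>s\<close> equal to \<open>3/2\<close> times the target exponent, the bound of \<open>mgf_second_order_bound\<close> is at
  most \<open>9/49 + 3/32 < 1/3 \<le> ln (\<surd>2)\<close>, for \<open>f\<close> and for \<open>- f\<close>, whatever the relative size of \<open>b\<close>
  and \<open>b0\<close>.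
\<close>

lemma second_order_concentration:
  assumes f: "bm f" and f0: "expectation f = 0"
    and u: "bm u" "\<And>x. x \<in> space P \<Longrightarrow> u x \<ge> 0"
    and fu: "AE x in P. (\<Sum>i\<in>I. (diff1 M i f x)\<^sup>2) \<le> 2 * b0\<^sup>2 + 2 * (u x)\<^sup>2"
    and grad: "AE x in P. (\<Sum>i\<in>I. (diff1 M i u x)\<^sup>2) \<le> 1"
    and ub: "expectation (\<lambda>x. (u x)\<^sup>2) \<le> b\<^sup>2" and b0: "b0 \<ge> 0"
  shows "expectation (\<lambda>x. exp (1 / (12 + 4 * b\<^sup>2 + 7 * b0) * \<bar>f x\<bar>)) \<le> 2"
proof -
  define D where "D = 12 + 4 * b\<^sup>2 + 7 * b0"
  define s where "s = 3 / 2 * (1 / D)"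
  have D: "D \<ge> 12" "D \<ge> 7 * b0" "D \<ge> 12 + 4 * b\<^sup>2" using b0 by (auto simp: D_def)
  have s: "0 < s" "s \<le> 1 / 8" using D by (auto simp: s_def field_simps)
  \<comment> \<open>\<open>D \<ge> 7 * b0\<close> controls the first-order term, \<open>D\<^sup>2 \<ge> 192 * b\<^sup>2\<close> the second-order term\<close>
  have "s * b0 \<le> 3 / 14" using D b0 by (simp add: s_def field_simps)
  then have "(s * b0)\<^sup>2 \<le> (3 / 14)\<^sup>2" using s b0 by (intro power_mono) auto
  then have 1: "4 * s\<^sup>2 * b0\<^sup>2 \<le> 9 / 49" by (simp add: power_mult_distrib power_divide)
  have "192 * b\<^sup>2 \<le> (12 + 4 * b\<^sup>2)\<^sup>2"
    using zero_le_power2[of "12 - 4 * b\<^sup>2"] by (simp add: power2_eq_square algebra_simps)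
  also have "\<dots> \<le> D\<^sup>2" using D by (intro power_mono) auto
  finally have "192 * b\<^sup>2 \<le> D\<^sup>2" .
  then have 2: "8 * s\<^sup>2 * b\<^sup>2 \<le> 3 / 32"
    using D by (simp add: s_def power_mult_distrib power_divide field_simps)
  have "(2::real) / 3 \<le> ln 2" by (rule ln2_ge_two_thirds)
  then have K: "4 * s\<^sup>2 * b0\<^sup>2 + 8 * s\<^sup>2 * b\<^sup>2 \<le> ln (sqrt 2)" using 1 2 by (simp add: ln_sqrt)
  have "ln (mgf f s) \<le> ln (sqrt 2)"
    using mgf_second_order_bound[OF f f0 u fu grad ub s] K by simp
  then have pos: "mgf f s \<le> sqrt 2" using mgf_pos[OF f, of s] by simp
  have "ln (mgf (\<lambda>x. - f x) s) \<le> ln (sqrt 2)"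
    using mgf_second_order_bound[OF bm_uminus[OF f] _ u _ grad ub s, of b0] K f0 fu by (simp add: diff1_uminus)
  then have neg: "mgf (\<lambda>x. - f x) s \<le> sqrt 2"
    using mgf_pos[OF bm_uminus[OF f], of s] by (subst (asm) ln_le_cancel_iff) auto
  show ?thesis unfolding D_def[symmetric]
    by (rule exp_abs_moment_le_2[OF f pos[unfolded s_def] neg[unfolded s_def]])
qed

section \<open>Second-order differences and the higher-order part\<close>

lemma upd_comp_measurable:
  assumes "i \<in> I" and X: "X \<in> N \<rightarrow>\<^sub>M P" and Y: "Y \<in> N \<rightarrow>\<^sub>M M i"
  shows "(\<lambda>w. (X w)(i := Y w)) \<in> N \<rightarrow>\<^sub>M P"
  using measurable_compose[OF measurable_Pair[OF X Y] upd_measurable[OF assms(1)]] by simp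

text \<open>
  The double difference in \<open>i\<close> and \<open>j\<close> is a difference in \<open>j\<close> of a difference in \<open>i\<close>. Applying
  the identity \<open>E (d\<^sub>i f)\<^sup>2 = E (f - avg i f)\<^sup>2\<close> once for each coordinate, with an exchange
  of integrals in between, turns the factor \<open>1/4\<close> into two factors \<open>1/2\<close>.
\<close>

lemma
  assumes f: "bm f" and i: "i \<in> I" and j: "j \<in> I" and ij: "i \<noteq> j"
  shows integrable_diff2_sq: "integrable P (\<lambda>x. (diff2 M i j f x)\<^sup>2)"
    and expectation_diff2_sq: "expectation (\<lambda>x. (diff2 M i j f x)\<^sup>2) =
      expectation (\<lambda>x. ((f x - avg j f x) - avg i (\<lambda>x. f x - avg j f x) x)\<^sup>2)"
proof -
  interpret Mi: prob_space "M i" using i by (rule prob_factor)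
  interpret Mj: prob_space "M j" using j by (rule prob_factor)
  interpret PM: pair_prob_space P "M i" ..
  define \<Delta> where "\<Delta> x y z = f x - f (x(i := y)) - f (x(j := z)) + f (x(i := y, j := z))" for x y z
  define G where "G x y = (\<integral>z. (\<Delta> x y z)\<^sup>2 \<partial>M j)" for x y
  have fm: "f \<in> borel_measurable P" by (rule bounded_measurable_measurable[OF f])
  obtain C where C: "C > 0" "\<And>x. x \<in> space P \<Longrightarrow> \<bar>f x\<bar> \<le> C" using bounded_measurable_bound[OF f] by metis
  have \<Delta>m: "(\<lambda>((x, y), z). (\<Delta> x y z)\<^sup>2) \<in> borel_measurable ((P \<Otimes>\<^sub>M M i) \<Otimes>\<^sub>M M j)"
    unfolding \<Delta>_def case_prod_beta
    by (intro borel_measurable_power borel_measurable_diff borel_measurable_add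
        measurable_compose[OF _ fm] upd_comp_measurable i j measurable_fst measurable_snd
        measurable_compose[OF measurable_fst measurable_fst] measurable_compose[OF measurable_fst measurable_snd])
  have Gm: "(\<lambda>(x, y). G x y) \<in> borel_measurable (P \<Otimes>\<^sub>M M i)"
    using Mj.borel_measurable_lebesgue_integral[of "\<lambda>p z. (\<Delta> (fst p) (snd p) z)\<^sup>2" "P \<Otimes>\<^sub>M M i"] \<Delta>m
    by (simp add: G_def[abs_def] case_prod_beta')
  have \<Delta>b: "(\<Delta> x y z)\<^sup>2 \<le> (4 * C)\<^sup>2" if "x \<in> space P" "y \<in> space (M i)" "z \<in> space (M j)" for x y z
  proof -
    have "\<bar>\<Delta> x y z\<bar> \<le> 4 * C"
      using C(2)[of x] C(2)[of "x(i := y)"] C(2)[of "x(j := z)"] C(2)[of "x(i := y, j := z)"] that i j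
      unfolding \<Delta>_def by (simp add: upd_space)
    then show ?thesis using C(1) by (intro power2_le_iff_abs_le[THEN iffD2]) auto
  qed
  have Gb: "norm (G x y) \<le> (4 * C)\<^sup>2" if "x \<in> space P" "y \<in> space (M i)" for x y
  proof -
    have "integrable (M j) (\<lambda>z. (\<Delta> x y z)\<^sup>2)"
      unfolding \<Delta>_def by (intro Mj.bm_integrable bm_intros bm_fiber f i j that upd_space)
    then have "G x y \<le> (4 * C)\<^sup>2" unfolding G_def using \<Delta>b[OF that]
      by (intro Mj.integral_le_const AE_I2)
    moreover have "0 \<le> G x y" by (simp add: G_def)
    ultimately show ?thesis by simp
  qed
  have Gint: "integrable (P \<Otimes>\<^sub>M M i) (\<lambda>(x, y). G x y)"
    using Gb Gm by (intro PM.integrable_const_bound[where B="(4*C)\<^sup>2"]) (auto simp: space_pair_measure)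
  have d2: "4 * (diff2 M i j f x)\<^sup>2 = (\<integral>y. G x y \<partial>M i)" for x
  proof -
    have "0 \<le> (\<integral>y. G x y \<partial>M i)" by (simp add: G_def)
    then show ?thesis by (simp add: diff2_def G_def \<Delta>_def)
  qed
  have "integrable P (\<lambda>x. \<integral>y. G x y \<partial>M i)"
    using PM.integrable_fst'[OF Gint] by simp
  then have "integrable P (\<lambda>x. 4 * (diff2 M i j f x)\<^sup>2)" by (simp only: d2)
  then show "integrable P (\<lambda>x. (diff2 M i j f x)\<^sup>2)" by simp
  define L where "L x = f x - avg j f x" for x
  have L: "bm L" unfolding L_def by (intro bm_intros f j)
  have inner: "(\<integral>x. G x y \<partial>P) = 2 * expectation (\<lambda>x. (L x - L (x(i := y)))\<^sup>2)" if y: "y \<in> space (M i)" for y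
  proof -
    let ?K = "\<lambda>x. f x - f (x(i := y))"
    have K': "bm (\<lambda>x. f (x(i := y)))"
      using C(2) y i by (intro bounded_measurableI[of _ _ C] measurable_compose[OF upd_comp_measurable fm]) (auto simp: upd_space)
    then have K: "bm ?K" by (intro bm_intros f)
    have "(\<integral>x. G x y \<partial>P) = expectation (\<lambda>x. 2 * (diff1 M j ?K x)\<^sup>2)"
    proof (intro Bochner_Integration.integral_cong refl)
      fix x
      have "0 \<le> G x y" by (simp add: G_def)
      moreover have "(\<integral>z. (?K x - ?K (x(j := z)))\<^sup>2 \<partial>M j) = G x y"
        unfolding G_def \<Delta>_def using ij
        by (intro Bochner_Integration.integral_cong) (auto simp: fun_upd_twist algebra_simps)
      ultimately show "G x y = 2 * (diff1 M j ?K x)\<^sup>2" by (simp add: diff1_def)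
    qed
    also have "\<dots> = 2 * expectation (\<lambda>x. (?K x - avg j ?K x)\<^sup>2)"
      using expectation_diff1_sq[OF K j] by simp
    also have "expectation (\<lambda>x. (?K x - avg j ?K x)\<^sup>2) = expectation (\<lambda>x. (L x - L (x(i := y)))\<^sup>2)"
    proof (intro Bochner_Integration.integral_cong refl)
      fix x assume x: "x \<in> space P"
      have "avg j (\<lambda>x. f (x(i := y))) x = avg j f (x(i := y))"
        unfolding avg_def using ij by (intro Bochner_Integration.integral_cong refl) (simp add: fun_upd_twist)
      then have "?K x - avg j ?K x = L x - L (x(i := y))"
        using avg_diff[OF f K' j x] by (simp add: L_def)
      then show "(?K x - avg j ?K x)\<^sup>2 = (L x - L (x(i := y)))\<^sup>2" by simp
    qed
    finally show ?thesis .
  qed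
  have Lm: "L \<in> borel_measurable P" by (rule bounded_measurable_measurable[OF L])
  obtain B where B: "B > 0" "\<And>x. x \<in> space P \<Longrightarrow> \<bar>L x\<bar> \<le> B" using bounded_measurable_bound[OF L] by metis
  have Lint: "integrable (P \<Otimes>\<^sub>M M i) (\<lambda>(x, y). (L x - L (x(i := y)))\<^sup>2)"
  proof (rule PM.integrable_const_bound[where B="(2*B)\<^sup>2"])
    show "(\<lambda>(x, y). (L x - L (x(i := y)))\<^sup>2) \<in> borel_measurable (P \<Otimes>\<^sub>M M i)"
      unfolding case_prod_beta
      by (intro borel_measurable_power borel_measurable_diff measurable_compose[OF _ Lm] upd_comp_measurable i
          measurable_fst measurable_snd)
    have "norm ((L x - L (x(i := y)))\<^sup>2) \<le> (2 * B)\<^sup>2" if "x \<in> space P" "y \<in> space (M i)" for x y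
    proof -
      have "\<bar>L x - L (x(i := y))\<bar> \<le> 2 * B"
        using B(2)[of x] B(2)[of "x(i := y)"] that i by (simp add: upd_space)
      then have "(L x - L (x(i := y)))\<^sup>2 \<le> (2 * B)\<^sup>2" using B(1) by (intro power2_le_iff_abs_le[THEN iffD2]) auto
      then show ?thesis by simp
    qed
    then show "AE z in P \<Otimes>\<^sub>M M i. norm (case z of (x, y) \<Rightarrow> (L x - L (x(i := y)))\<^sup>2) \<le> (2 * B)\<^sup>2"
      by (intro AE_I2) (auto simp: space_pair_measure)
  qed
  have "4 * expectation (\<lambda>x. (diff2 M i j f x)\<^sup>2) = (\<integral>x. \<integral>y. G x y \<partial>M i \<partial>P)"
    by (simp flip: d2)
  also have "\<dots> = (\<integral>y. \<integral>x. G x y \<partial>P \<partial>M i)"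
    using PM.Fubini_integral[OF Gint] by simp
  also have "\<dots> = (\<integral>y. 2 * expectation (\<lambda>x. (L x - L (x(i := y)))\<^sup>2) \<partial>M i)"
    by (intro Bochner_Integration.integral_cong refl inner)
  also have "\<dots> = 2 * (\<integral>x. \<integral>y. (L x - L (x(i := y)))\<^sup>2 \<partial>M i \<partial>P)"
    using PM.Fubini_integral[OF Lint] by simp
  also have "\<dots> = 2 * expectation (\<lambda>x. 2 * (diff1 M i L x)\<^sup>2)"
    by (simp add: diff1_def)
  also have "\<dots> = 4 * expectation (\<lambda>x. (L x - avg i L x)\<^sup>2)"
    using expectation_diff1_sq[OF L i] by simp
  finally show "expectation (\<lambda>x. (diff2 M i j f x)\<^sup>2) =
      expectation (\<lambda>x. ((f x - avg j f x) - avg i (\<lambda>x. f x - avg j f x) x)\<^sup>2)"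
    by (simp add: L_def[abs_def])
qed

text \<open>
  The conditional expectation of \<open>f\<close> given coordinate \<open>l\<close>, which for centred \<open>f\<close> is the summand
  of the first Hoeffding term that depends on \<open>x\<^sub>l\<close>.
\<close>

definition main_effect :: "nat \<Rightarrow> ((nat \<Rightarrow> 'a) \<Rightarrow> real) \<Rightarrow> (nat \<Rightarrow> 'a) \<Rightarrow> real" where
  "main_effect l f = avgs (sorted_list_of_set (I - {l})) f"

lemma set_others: "set (sorted_list_of_set (I - {l})) = I - {l}"
  using finite_index by simp

lemma bm_main_effect [bm_intros]: "bm f \<Longrightarrow> bm (main_effect l f)"
  unfolding main_effect_def by (intro bm_avgs) (auto simp: set_others)

lemma indep_main_effect: "k \<in> I \<Longrightarrow> k \<noteq> l \<Longrightarrow> indep_coord k (main_effect l f)"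
  unfolding main_effect_def by (rule indep_avgs_mem) (auto simp: set_others)

lemma avg_sum:
  assumes "\<And>l. l \<in> A \<Longrightarrow> bm (g l)" "i \<in> I" "x \<in> space P"
  shows "avg i (\<lambda>x. \<Sum>l\<in>A. g l x) x = (\<Sum>l\<in>A. avg i (g l) x)"
  unfolding avg_def using assms by (intro Bochner_Integration.integral_sum fiber_integrable)

text \<open>
  The other main effects do not depend on \<open>x\<^sub>j\<close>, so the fluctuation of \<open>R\<close> in \<open>j\<close> is
  \<open>g = f - avg j f - main_effect j f\<close>. Its average over all coordinates other than \<open>j\<close> vanishes,
  and the Efron-Stein inequality over these coordinates applies. In a coordinate \<open>k \<noteq> j\<close> the main
  effect of \<open>j\<close> does not fluctuate, which leaves the mixed fluctuation of \<open>f\<close>.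
\<close>

lemma higher_order_part_fluctuation:
  assumes f: "bm f" and f0: "expectation f = 0" and j: "j \<in> I"
  defines "R \<equiv> \<lambda>x. f x - (\<Sum>l\<in>I. main_effect l f x)"
  shows "expectation (\<lambda>x. (R x - avg j R x)\<^sup>2) \<le> (\<Sum>i\<in>I - {j}. expectation (\<lambda>x. (diff2 M i j f x)\<^sup>2))"
proof -
  define g where "g x = f x - avg j f x - main_effect j f x" for x
  define L where "L x = f x - avg j f x" for x
  have L: "bm L" unfolding L_def by (intro bm_intros f j)
  have gL: "g = (\<lambda>x. L x - main_effect j f x)" by (simp add: g_def L_def fun_eq_iff)
  have g: "bm g" unfolding gL by (intro bm_intros f L)
  have Rg: "R x - avg j R x = g x" if x: "x \<in> space P" for x
  proof -
    have const: "avg j (main_effect j f) x = 0"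
    proof -
      have "avg j (main_effect j f) x = expectation (avg j (main_effect j f))"
      proof (rule indep_all_const[OF _ x])
        fix k assume k: "k \<in> I"
        show "indep_coord k (avg j (main_effect j f))"
          using indep_avg_same[OF j] indep_avg[OF indep_main_effect[of k j f] j k] k by (cases "k = j") auto
      qed
      also have "\<dots> = expectation (main_effect j f)" by (intro expectation_avg j bm_intros f)
      also have "\<dots> = 0" unfolding main_effect_def
        by (subst expectation_avgs) (auto simp: set_others f f0)
      finally show ?thesis .
    qed
    have "avg j R x = avg j f x - (\<Sum>l\<in>I. avg j (main_effect l f) x)"
      unfolding R_def using avg_diff[OF f bm_sum[of I P "\<lambda>l. main_effect l f"] j x]
        avg_sum[of I "\<lambda>l. main_effect l f" j x] bm_main_effect[OF f] j x by simp
    also have "(\<Sum>l\<in>I. avg j (main_effect l f) x) = (\<Sum>l\<in>I. if l = j then 0 else main_effect l f x)"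
      using const j x by (intro sum.cong refl) (auto intro!: avg_of_indep indep_main_effect)
    also have "\<dots> = (\<Sum>l\<in>I. main_effect l f x) - main_effect j f x"
      using finite_index j by (simp add: sum.remove[of I j])
    finally show ?thesis by (simp add: R_def g_def)
  qed
  let ?ks = "sorted_list_of_set (I - {j})"
  have ks: "set ?ks \<subseteq> I" by (auto simp: set_others)
  have g0: "avgs ?ks g x = 0" if x: "x \<in> space P" for x
  proof -
    have "avgs ?ks (avg j f) x = expectation (avgs ?ks (avg j f))"
    proof (rule indep_all_const[OF _ x])
      fix k assume k: "k \<in> I"
      show "indep_coord k (avgs ?ks (avg j f))"
        using indep_avgs[OF indep_avg_same[OF j] ks j] indep_avgs_mem[OF ks, of k] k
        by (cases "k = j") (auto simp: set_others)
    qed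
    also have "\<dots> = 0" using f j ks f0 by (simp add: expectation_avgs bm_avg expectation_avg bm_integrable)
    finally have "avgs ?ks (avg j f) x = 0" .
    moreover have "avgs ?ks (main_effect j f) x = main_effect j f x"
      by (rule avgs_of_indep[OF ks _ x]) (auto simp: set_others intro: indep_main_effect)
    moreover have "avgs ?ks g x = avgs ?ks L x - avgs ?ks (main_effect j f) x"
      unfolding gL by (rule avgs_diff[OF ks L bm_main_effect[OF f] x])
    moreover have "avgs ?ks L x = avgs ?ks f x - avgs ?ks (avg j f) x"
      unfolding L_def by (rule avgs_diff[OF ks f bm_avg[OF f j] x])
    ultimately show ?thesis by (simp add: main_effect_def)
  qed
  have "expectation (\<lambda>x. (R x - avg j R x)\<^sup>2) = expectation (\<lambda>x. (g x - avgs ?ks g x)\<^sup>2)"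
    by (intro Bochner_Integration.integral_cong refl) (simp add: Rg g0)
  also have "\<dots> \<le> (\<Sum>k\<leftarrow>?ks. expectation (\<lambda>x. (g x - avg k g x)\<^sup>2))"
    by (rule efron_stein[OF g ks])
  also have "\<dots> = (\<Sum>k\<in>I - {j}. expectation (\<lambda>x. (g x - avg k g x)\<^sup>2))"
    using finite_index by (subst sum_list_distinct_conv_sum_set) auto
  also have "\<dots> = (\<Sum>k\<in>I - {j}. expectation (\<lambda>x. (diff2 M k j f x)\<^sup>2))"
  proof (rule sum.cong[OF refl])
    fix k assume k: "k \<in> I - {j}"
    have "expectation (\<lambda>x. (g x - avg k g x)\<^sup>2) = expectation (\<lambda>x. (L x - avg k L x)\<^sup>2)"
    proof (intro Bochner_Integration.integral_cong refl)
      fix x assume x: "x \<in> space P"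
      have "avg k g x = avg k L x - avg k (main_effect j f) x"
        unfolding gL using k x by (intro avg_diff L bm_intros f) auto
      also have "avg k (main_effect j f) x = main_effect j f x"
        using k x by (intro avg_of_indep indep_main_effect) auto
      finally show "(g x - avg k g x)\<^sup>2 = (L x - avg k L x)\<^sup>2" by (simp add: gL)
    qed
    then show "expectation (\<lambda>x. (g x - avg k g x)\<^sup>2) = expectation (\<lambda>x. (diff2 M k j f x)\<^sup>2)"
      using expectation_diff2_sq[OF f _ j, of k] k by (simp add: L_def[abs_def])
  qed
  finally show ?thesis .
qed

lemma higher_order_part_energy:
  assumes f: "bm f" and f0: "expectation f = 0"
  defines "R \<equiv> \<lambda>x. f x - (\<Sum>l\<in>I. main_effect l f x)"
  shows "expectation (\<lambda>x. \<Sum>j\<in>I. (diff1 M j R x)\<^sup>2)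
    \<le> expectation (\<lambda>x. \<Sum>i\<in>I. \<Sum>j\<in>I. (hess M f x i j)\<^sup>2)"
proof -
  have R: "bm R" unfolding R_def by (intro bm_intros f)
  have "expectation (\<lambda>x. \<Sum>j\<in>I. (diff1 M j R x)\<^sup>2) = (\<Sum>j\<in>I. expectation (\<lambda>x. (diff1 M j R x)\<^sup>2))"
    by (intro Bochner_Integration.integral_sum bm_intros R)
  also have "\<dots> = (\<Sum>j\<in>I. expectation (\<lambda>x. (R x - avg j R x)\<^sup>2))"
    by (intro sum.cong refl expectation_diff1_sq R)
  also have "\<dots> \<le> (\<Sum>j\<in>I. \<Sum>i\<in>I - {j}. expectation (\<lambda>x. (diff2 M i j f x)\<^sup>2))"
    unfolding R_def by (intro sum_mono higher_order_part_fluctuation f f0)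
  also have "\<dots> = (\<Sum>j\<in>I. \<Sum>i\<in>I. expectation (\<lambda>x. (hess M f x i j)\<^sup>2))"
  proof (rule sum.cong[OF refl])
    fix j assume j: "j \<in> I"
    show "(\<Sum>i\<in>I - {j}. expectation (\<lambda>x. (diff2 M i j f x)\<^sup>2)) = (\<Sum>i\<in>I. expectation (\<lambda>x. (hess M f x i j)\<^sup>2))"
      using finite_index j by (subst sum.remove[of I j]) (auto simp: hess_def intro!: sum.cong)
  qed
  also have "\<dots> = (\<Sum>i\<in>I. \<Sum>j\<in>I. expectation (\<lambda>x. (hess M f x i j)\<^sup>2))"
    by (rule sum.swap)
  also have "\<dots> = expectation (\<lambda>x. \<Sum>i\<in>I. \<Sum>j\<in>I. (hess M f x i j)\<^sup>2)"
  proof -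
    have "integrable P (\<lambda>x. (hess M f x i j)\<^sup>2)" if "i \<in> I" "j \<in> I" for i j
      using integrable_diff2_sq[OF f that] by (cases "i = j") (simp_all add: hess_def)
    then show ?thesis by simp
  qed
  finally show ?thesis .
qed

section \<open>Identification of the first Hoeffding term\<close>

lemma distr_restrict_subset:
  assumes S: "S \<subseteq> I"
  shows "distr P (Pi\<^sub>M S M) (\<lambda>x. restrict x S) = Pi\<^sub>M S M"
proof (rule measure_eqI_PiM_finite[symmetric])
  have fS: "finite S" using S finite_index by (rule finite_subset)
  have pS: "prob_space (Pi\<^sub>M S M)" using S by (intro prob_space_PiM prob_factor) auto
  show "finite S" by (rule fS)
  show "sets (Pi\<^sub>M S M) = sets (Pi\<^sub>M S M)" "sets (distr P (Pi\<^sub>M S M) (\<lambda>x. restrict x S)) = sets (Pi\<^sub>M S M)"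
    by auto
  show "range (\<lambda>_::nat. space (Pi\<^sub>M S M)) \<subseteq> prod_algebra S M"
    using prod_algebraI_finite[OF fS, of "\<lambda>i. space (M i)" M] by (auto simp: space_PiM)
  show "(\<Union>i::nat. space (Pi\<^sub>M S M)) = space (Pi\<^sub>M S M)" by simp
  show "emeasure (Pi\<^sub>M S M) (space (Pi\<^sub>M S M)) \<noteq> \<infinity>" for i :: nat
    using prob_space.emeasure_space_1[OF pS] by simp
  fix A assume A: "\<And>j. j \<in> S \<Longrightarrow> A j \<in> sets (M j)"
  have "emeasure (distr P (Pi\<^sub>M S M) (\<lambda>x. restrict x S)) (Pi\<^sub>E S A)
      = emeasure P ((\<lambda>x. restrict x S) -` Pi\<^sub>E S A \<inter> space P)"
    using A fS by (intro emeasure_distr measurable_restrict_subset S sets_PiM_I_finite)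
  also have "(\<lambda>x. restrict x S) -` Pi\<^sub>E S A \<inter> space P = prod_emb I M S (Pi\<^sub>E S A)"
    by (simp add: prod_emb_def space_PiM)
  also have "emeasure P \<dots> = (\<Prod>j\<in>S. emeasure (M j) (A j))"
    by (rule emeasure_PiM_emb[of I M S A, OF prob_factor S fS A])
  also have "\<dots> = emeasure (Pi\<^sub>M S M) (prod_emb S M S (Pi\<^sub>E S A))"
    using S by (intro emeasure_PiM_emb[symmetric] prob_factor fS A) auto
  also have "prod_emb S M S (Pi\<^sub>E S A) = Pi\<^sub>E S A"
    using A by (intro prod_emb_PiE_same_index) (auto dest: sets.sets_into_space)
  finally show "emeasure (Pi\<^sub>M S M) (Pi\<^sub>E S A) = emeasure (distr P (Pi\<^sub>M S M) (\<lambda>x. restrict x S)) (Pi\<^sub>E S A)"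
    by (rule sym)
qed

lemma integrable_restrict:
  fixes k :: "(nat \<Rightarrow> 'a) \<Rightarrow> real"
  assumes S: "S \<subseteq> I" and "integrable (Pi\<^sub>M S M) k"
  shows "integrable P (\<lambda>x. k (restrict x S))"
  using assms integrable_distr[OF measurable_restrict_subset[OF S], of M k] by (simp add: distr_restrict_subset)

lemma AE_restrict:
  assumes S: "S \<subseteq> I" and "AE x in Pi\<^sub>M S M. Q x"
  shows "AE x in P. Q (restrict x S)"
proof -
  have "AE x in distr P (Pi\<^sub>M S M) (\<lambda>x. restrict x S). Q x"
    using assms(2) by (simp only: distr_restrict_subset[OF S])
  then show ?thesis by (rule AE_distrD[OF measurable_restrict_subset[OF S]])
qed

lemma integrable_mult_bm:
  assumes H: "integrable P H" and q: "bm q"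
  shows "integrable P (\<lambda>x. q x * H x)"
proof -
  obtain C where C: "\<And>x. x \<in> space P \<Longrightarrow> \<bar>q x\<bar> \<le> C" using bounded_measurable_bound[OF q] by metis
  have [measurable]: "q \<in> borel_measurable P" "H \<in> borel_measurable P"
    using bounded_measurable_measurable[OF q] H by auto
  show ?thesis
  proof (rule Bochner_Integration.integrable_bound)
    show "integrable P (\<lambda>x. C * H x)" using H by simp
    show "AE x in P. norm (q x * H x) \<le> norm (C * H x)"
      by (intro AE_I2) (auto simp: abs_mult intro!: mult_right_mono order.trans[OF C abs_ge_self])
  qed measurable
qed

text \<open>
  Averaging over \<open>j\<close> first annihilates the kernel and leaves the test function untouched.
\<close>

lemma degenerate_kernel_orthogonal:
  assumes S: "S \<subseteq> I" and j: "j \<in> S" and int: "integrable (Pi\<^sub>M S M) k"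
    and zero: "AE x in Pi\<^sub>M S M. (\<integral>y. k (x(j := y)) \<partial>M j) = 0"
    and q: "bm q" "indep_coord j q"
  shows "expectation (\<lambda>x. q x * k (restrict x S)) = 0"
proof -
  have jI: "j \<in> I" using S j by auto
  let ?H = "\<lambda>x. k (restrict x S)"
  have upd: "restrict (x(j := y)) S = (restrict x S)(j := y)" for x y using j by auto
  have "expectation (\<lambda>x. q x * ?H x) = expectation (avg j (\<lambda>x. q x * ?H x))"
    by (intro expectation_avg[symmetric] jI integrable_mult_bm integrable_restrict S int q)
  also have "\<dots> = expectation (\<lambda>x. q x * avg j ?H x)"
    by (intro Bochner_Integration.integral_cong refl avg_mult_indep q jI)
  also have "\<dots> = 0"
  proof (rule integral_eq_zero_AE)
    show "AE x in P. q x * avg j ?H x = 0"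
      using AE_restrict[OF S zero] by eventually_elim (simp add: avg_def upd)
  qed
  finally show ?thesis .
qed

text \<open>
  The kernels are merely integrable, so they are compared with the main effects by duality: a
  bounded function of \<open>x\<^sub>l\<close> alone is orthogonal to every kernel except \<open>h {l}\<close>, and pairs in the same
  way with \<open>f\<close> and with \<open>main_effect l f\<close>. The sign of the difference is such a test function.
\<close>

lemma main_effect_unique:
  assumes f: "bm f"
    and int: "\<And>S. S \<subseteq> I \<Longrightarrow> S \<noteq> {} \<Longrightarrow> integrable (Pi\<^sub>M S M) (h S)"
    and zero: "\<And>S j. S \<subseteq> I \<Longrightarrow> j \<in> S \<Longrightarrow> AE x in Pi\<^sub>M S M. (\<integral>y. h S (x(j := y)) \<partial>M j) = 0"
    and dec: "AE x in P. f x = (\<Sum>S\<in>Pow I - {{}}. h S (restrict x S))"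
    and l: "l \<in> I"
  shows "AE x in P. h {l} (restrict x {l}) = main_effect l f x"
proof -
  let ?H = "\<lambda>S x. h S (restrict x S)"
  let ?ks = "sorted_list_of_set (I - {l})"
  have ks: "set ?ks \<subseteq> I" by (auto simp: set_others)
  have intH: "integrable P (?H S)" if "S \<in> Pow I - {{}}" for S
    using that by (intro integrable_restrict int) auto
  have intl: "integrable P (?H {l})" using l by (intro intH) auto
  define d where "d x = main_effect l f x - ?H {l} x" for x
  have intd: "integrable P d" unfolding d_def by (intro Bochner_Integration.integrable_diff intl bm_intros f)
  \<comment> \<open>tested against its own sign, the difference gives its L1 norm\<close>
  define q where "q x = sgn (d x)" for x
  have "d \<in> borel_measurable P" using intd by auto
  then have q: "bm q" unfolding q_def by (intro bounded_measurableI[where C = 1]) (auto simp: sgn_if)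
  have indq: "indep_coord j q" if "j \<in> I" "j \<noteq> l" for j
  proof -
    have "restrict (x(j := y)) {l} = restrict x {l}" for x :: "nat \<Rightarrow> 'a" and y using that by auto
    then show ?thesis
      using indep_main_effect[OF that, of f] by (auto simp: indep_coord_def q_def d_def)
  qed
  have fq: "expectation (\<lambda>x. q x * f x) = expectation (\<lambda>x. q x * ?H {l} x)"
  proof -
    have "expectation (\<lambda>x. q x * f x) = expectation (\<lambda>x. \<Sum>S\<in>Pow I - {{}}. q x * ?H S x)"
    proof (rule integral_cong_AE)
      show "AE x in P. q x * f x = (\<Sum>S\<in>Pow I - {{}}. q x * ?H S x)"
        using dec by eventually_elim (simp add: sum_distrib_left)
      show "(\<lambda>x. q x * f x) \<in> borel_measurable P"
        by (intro bounded_measurable_measurable bm_intros q f)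
      show "(\<lambda>x. \<Sum>S\<in>Pow I - {{}}. q x * ?H S x) \<in> borel_measurable P"
        by (intro borel_measurable_sum borel_measurable_integrable integrable_mult_bm intH q)
    qed
    also have "\<dots> = (\<Sum>S\<in>Pow I - {{}}. expectation (\<lambda>x. q x * ?H S x))"
      by (intro Bochner_Integration.integral_sum integrable_mult_bm intH q)
    also have "\<dots> = (\<Sum>S\<in>Pow I - {{}}. if S = {l} then expectation (\<lambda>x. q x * ?H {l} x) else 0)"
    proof (rule sum.cong[OF refl])
      fix S assume S: "S \<in> Pow I - {{}}"
      show "expectation (\<lambda>x. q x * ?H S x) = (if S = {l} then expectation (\<lambda>x. q x * ?H {l} x) else 0)"
      proof (cases "S = {l}")
        case False
        then obtain j where j: "j \<in> S" "j \<noteq> l" using S by auto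
        have "expectation (\<lambda>x. q x * ?H S x) = 0"
        proof (rule degenerate_kernel_orthogonal[OF _ j(1) int _ q])
          show S': "S \<subseteq> I" "S \<subseteq> I" "S \<noteq> {}" using S by auto
          show "AE x in Pi\<^sub>M S M. (\<integral>y. h S (x(j := y)) \<partial>M j) = 0" by (rule zero[OF S'(1) j(1)])
          show "indep_coord j q" using S j by (intro indq) auto
        qed
        then show ?thesis using False by simp
      qed simp
    qed
    also have "\<dots> = expectation (\<lambda>x. q x * ?H {l} x)"
      using finite_index l by simp
    finally show ?thesis .
  qed
  have "expectation (\<lambda>x. q x * main_effect l f x) = expectation (avgs ?ks (\<lambda>x. q x * f x))"
    unfolding main_effect_def
    by (intro Bochner_Integration.integral_cong refl avgs_mult_indep[symmetric] ks) (auto simp: set_others intro: indq)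
  also have "\<dots> = expectation (\<lambda>x. q x * f x)" by (intro expectation_avgs ks bm_intros q f)
  finally have "expectation (\<lambda>x. q x * main_effect l f x) = expectation (\<lambda>x. q x * ?H {l} x)" using fq by simp
  moreover have "integrable P (\<lambda>x. q x * main_effect l f x)" "integrable P (\<lambda>x. q x * ?H {l} x)"
    by (intro bm_intros q f integrable_mult_bm intl)+
  ultimately have "expectation (\<lambda>x. q x * d x) = 0" by (simp add: d_def right_diff_distrib)
  moreover have "(\<lambda>x. q x * d x) = (\<lambda>x. \<bar>d x\<bar>)" by (auto simp: q_def abs_sgn mult.commute)
  ultimately have "expectation (\<lambda>x. \<bar>d x\<bar>) = 0" by simp
  then have "AE x in P. \<bar>d x\<bar> = 0"
    using intd by (subst (asm) integral_nonneg_eq_0_iff_AE) auto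
  then show ?thesis by eventually_elim (simp add: d_def)
qed

lemma diff1_measurable:
  assumes i: "i \<in> I" and g: "g \<in> borel_measurable P"
  shows "diff1 M i g \<in> borel_measurable P"
proof -
  interpret Mi: prob_space "M i" using i by (rule prob_factor)
  have [measurable]: "(\<lambda>(x, y). (g x - g (x(i := y)))\<^sup>2) \<in> borel_measurable (P \<Otimes>\<^sub>M M i)"
    unfolding case_prod_beta
    by (intro borel_measurable_power borel_measurable_diff measurable_compose[OF _ g] upd_comp_measurable i
        measurable_fst measurable_snd)
  show ?thesis unfolding diff1_def[abs_def] by measurable
qed

text \<open>
  For almost every point, resampling one coordinate avoids a given null set almost surely, so the
  integrals over the fibre agree.
\<close>

lemma diff1_cong_AE:
  assumes i: "i \<in> I" and g: "g \<in> borel_measurable P" and k: "k \<in> borel_measurable P"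
    and eq: "AE x in P. g x = k x"
  shows "AE x in P. diff1 M i g x = diff1 M i k x"
  using eq AE_upd[OF i eq] AE_space
proof eventually_elim
  case (elim x)
  have "(\<lambda>y. g (x(i := y))) \<in> borel_measurable (M i)" "(\<lambda>y. k (x(i := y))) \<in> borel_measurable (M i)"
    using measurable_compose[OF upd_measurable'[OF i elim(3)]] g k by blast+
  moreover have "AE y in M i. (g x - g (x(i := y)))\<^sup>2 = (k x - k (x(i := y)))\<^sup>2"
    using elim(2) by eventually_elim (simp add: elim(1))
  ultimately have "(\<integral>y. (g x - g (x(i := y)))\<^sup>2 \<partial>M i) = (\<integral>y. (k x - k (x(i := y)))\<^sup>2 \<partial>M i)"
    by (intro integral_cong_AE) auto
  then show ?case by (simp add: diff1_def)
qed

lemma energy_cong_AE: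
  assumes g: "g \<in> borel_measurable P" and k: "k \<in> borel_measurable P"
    and eq: "AE x in P. g x = k x"
  shows "AE x in P. (\<Sum>i\<in>I. (diff1 M i g x)\<^sup>2) = (\<Sum>i\<in>I. (diff1 M i k x)\<^sup>2)"
proof -
  have "AE x in P. \<forall>i\<in>I. diff1 M i g x = diff1 M i k x"
    using finite_index diff1_cong_AE[OF _ g k eq] by (simp add: AE_finite_all)
  then show ?thesis by eventually_elim simp
qed

lemma diff1_sq_add_le:
  assumes f: "bm f" and g: "bm g" and i: "i \<in> I" and x: "x \<in> space P"
  shows "(diff1 M i (\<lambda>x. f x + g x) x)\<^sup>2 \<le> 2 * (diff1 M i f x)\<^sup>2 + 2 * (diff1 M i g x)\<^sup>2"
proof -
  interpret Mi: prob_space "M i" using i by (rule prob_factor)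
  let ?u = "\<lambda>y. x(i := y)"
  have int: "integrable (M i) (\<lambda>y. (f x - f (?u y))\<^sup>2)" "integrable (M i) (\<lambda>y. (g x - g (?u y))\<^sup>2)"
    "integrable (M i) (\<lambda>y. (f x + g x - (f (?u y) + g (?u y)))\<^sup>2)"
    by (intro Mi.bm_integrable bm_intros bm_fiber f g i x)+
  have "(\<integral>y. (f x + g x - (f (?u y) + g (?u y)))\<^sup>2 \<partial>M i) \<le> (\<integral>y. 2 * (f x - f (?u y))\<^sup>2 + 2 * (g x - g (?u y))\<^sup>2 \<partial>M i)"
  proof (intro integral_mono)
    fix y
    have "(a + b)\<^sup>2 \<le> 2 * a\<^sup>2 + 2 * b\<^sup>2" for a b :: real
      using zero_le_power2[of "a - b"] by (simp add: power2_eq_square algebra_simps)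
    from this[of "f x - f (?u y)" "g x - g (?u y)"]
    show "(f x + g x - (f (?u y) + g (?u y)))\<^sup>2 \<le> 2 * (f x - f (?u y))\<^sup>2 + 2 * (g x - g (?u y))\<^sup>2"
      by (simp add: algebra_simps)
  qed (use int in auto)
  also have "\<dots> = 2 * (\<integral>y. (f x - f (?u y))\<^sup>2 \<partial>M i) + 2 * (\<integral>y. (g x - g (?u y))\<^sup>2 \<partial>M i)"
    using int by simp
  finally show ?thesis by (simp add: diff1_def)
qed

end

section \<open>Concentration from the Hoeffding decomposition\<close>

lemma grad_norm_eq: "grad_norm n M g x = sqrt (\<Sum>i\<in>{1..n}. (diff1 M i g x)\<^sup>2)"
  by (simp add: grad_norm_def L2_set_def)

lemma hoeffding_term_1: "hoeffding_term n h 1 x = (\<Sum>l\<in>{1..n}. h {l} (restrict x {l}))"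
proof -
  have "{S. S \<subseteq> {1..n} \<and> card S = 1} = (\<lambda>l. {l}) ` {1..n}"
    by (auto simp: card_1_singleton_iff image_iff)
  then show ?thesis unfolding hoeffding_term_def by (simp add: sum.reindex)
qed

lemma sum_hoeffding_terms:
  "(\<Sum>k\<in>{1..n}. hoeffding_term n h k x) = (\<Sum>S\<in>Pow {1..n} - {{}}. h S (restrict x S))"
proof -
  have "(\<Sum>k\<in>{1..n}. hoeffding_term n h k x) = (\<Sum>k\<in>{1..n}. \<Sum>S | S \<in> Pow {1..n} - {{}} \<and> card S = k. h S (restrict x S))"
  proof (rule sum.cong[OF refl])
    fix k assume "k \<in> {1..n}"
    then have "{S. S \<subseteq> {1..n} \<and> card S = k} = {S. S \<in> Pow {1..n} - {{}} \<and> card S = k}" by auto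
    then show "hoeffding_term n h k x = (\<Sum>S | S \<in> Pow {1..n} - {{}} \<and> card S = k. h S (restrict x S))"
      by (simp add: hoeffding_term_def)
  qed
  also have "\<dots> = (\<Sum>S\<in>Pow {1..n} - {{}}. h S (restrict x S))"
  proof (rule sum.group)
    show "card ` (Pow {1..n} - {{}}) \<subseteq> {1..n}"
    proof (rule image_subsetI)
      fix S assume "S \<in> Pow {1..n} - {{}}"
      then have S: "S \<subseteq> {1..n}" "S \<noteq> {}" by auto
      then have "finite S" using finite_subset by blast
      then show "card S \<in> {1..n}"
        using S card_mono[of "{1..n}" S] by (auto simp: Suc_le_eq card_gt_0_iff)
    qed
  qed auto
  finally show ?thesis .
qed

theorem theorem1p3:
  fixes n :: nat
    and M :: "nat \<Rightarrow> 'a measure"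
    and f :: "(nat \<Rightarrow> 'a) \<Rightarrow> real"
    and h :: "nat set \<Rightarrow> (nat \<Rightarrow> 'a) \<Rightarrow> real"
    and b b0 :: real
  assumes "\<And>i. i \<in> {1..n} \<Longrightarrow> prob_space (M i)"
    and "f \<in> borel_measurable (Pi\<^sub>M {1..n} M)"
    and "bounded (f ` space (Pi\<^sub>M {1..n} M))"
    and "hoeffding_decomposition n M f h"
    and "(\<integral>x. f x \<partial>Pi\<^sub>M {1..n} M) = 0"
    and "b0 \<ge> 0"
    and "\<forall>x \<in> space (Pi\<^sub>M {1..n} M). grad_norm n M (hoeffding_term n h 1) x \<le> b0"
    and "\<forall>x \<in> space (Pi\<^sub>M {1..n} M).
           grad_norm n M (grad_norm n M (hoeffding_remainder n h)) x \<le> 1"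
    and "b \<ge> 0"
    and "(\<integral>x. (hs_norm n (hess M f x))\<^sup>2 \<partial>Pi\<^sub>M {1..n} M) \<le> b\<^sup>2"
  shows "(\<integral>x. exp (1 / (12 + 4 * b\<^sup>2 + 7 * b0) * \<bar>f x\<bar>) \<partial>Pi\<^sub>M {1..n} M) \<le> 2"
proof -
  let ?I = "{1..n}"
  interpret finite_product_prob ?I M
    by (rule finite_product_prob.intro[OF finite_atLeastAtMost assms(1)])
  obtain C where C: "\<forall>y\<in>f ` space P. norm y \<le> C" using assms(3) unfolding bounded_iff by blast
  have f: "bm f" by (rule bounded_measurableI[of _ _ C]) (use assms(2) C in auto)
  define F1 where "F1 = hoeffding_term n h 1"
  define F2 where "F2 = hoeffding_remainder n h"
  \<comment> \<open>\<open>f1\<close>, \<open>R\<close> and \<open>u\<close> are the bounded versions of \<open>F1\<close>, \<open>F2\<close> and \<open>grad_norm n M F2\<close>\<close>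
  define f1 where "f1 x = (\<Sum>l\<in>?I. main_effect l f x)" for x
  define R where "R x = f x - f1 x" for x
  define u where "u x = sqrt (\<Sum>i\<in>?I. (diff1 M i R x)\<^sup>2)" for x
  have int: "integrable (Pi\<^sub>M S M) (h S)" if "S \<subseteq> ?I" "S \<noteq> {}" for S
    using assms(4) that unfolding hoeffding_decomposition_def by blast
  have zero: "AE x in Pi\<^sub>M S M. (\<integral>y. h S (x(j := y)) \<partial>M j) = 0" if "S \<subseteq> ?I" "j \<in> S" for S j
    using assms(4) that unfolding hoeffding_decomposition_def by blast
  have dec: "AE x in P. f x = (\<Sum>k\<in>?I. hoeffding_term n h k x)"
    using assms(4) unfolding hoeffding_decomposition_def assms(5) by simp
  then have dec': "AE x in P. f x = (\<Sum>S\<in>Pow ?I - {{}}. h S (restrict x S))"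
    by (simp only: sum_hoeffding_terms)
  have F_meas: "hoeffding_term n h k \<in> borel_measurable P" if "k \<ge> 1" for k
    unfolding hoeffding_term_def[abs_def]
  proof (rule borel_measurable_sum)
    fix S assume "S \<in> {S. S \<subseteq> ?I \<and> card S = k}"
    then have "S \<subseteq> ?I" "S \<noteq> {}" using that by auto
    then show "(\<lambda>x. h S (restrict x S)) \<in> borel_measurable P"
      by (intro borel_measurable_integrable integrable_restrict int)
  qed
  have F1m: "F1 \<in> borel_measurable P" unfolding F1_def by (rule F_meas) simp
  have F2m: "F2 \<in> borel_measurable P" unfolding F2_def hoeffding_remainder_def[abs_def]
    by (intro borel_measurable_sum F_meas) auto
  have f1: "bm f1" unfolding f1_def by (intro bm_intros f)
  have R: "bm R" unfolding R_def by (intro bm_intros f f1)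
  have u: "bm u" unfolding u_def by (intro bm_intros R)
  have u0: "u x \<ge> 0" for x by (simp add: u_def sum_nonneg)
  have usq: "(u x)\<^sup>2 = (\<Sum>i\<in>?I. (diff1 M i R x)\<^sup>2)" for x by (simp add: u_def sum_nonneg)
  have "AE x in P. \<forall>l\<in>?I. h {l} (restrict x {l}) = main_effect l f x"
    by (rule AE_finite_allI[OF finite_atLeastAtMost main_effect_unique[OF f int zero dec']])
  then have F1: "AE x in P. F1 x = f1 x"
    by eventually_elim (simp add: F1_def f1_def hoeffding_term_1[unfolded One_nat_def])
  have F2: "AE x in P. F2 x = R x"
    using F1 dec
  proof eventually_elim
    case (elim x)
    have "(\<Sum>k\<in>?I. hoeffding_term n h k x) = F1 x + F2 x"
    \<comment> \<open>for \<open>n = 0\<close> the range \<open>{1..n}\<close> has no index 1 to split off\<close>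
    proof (cases "n = 0")
      case True
      then show ?thesis by (simp add: F1_def F2_def hoeffding_remainder_def hoeffding_term_1[unfolded One_nat_def])
    next
      case False
      then have "?I = insert 1 {2..n}" by auto
      then show ?thesis by (simp add: F1_def F2_def hoeffding_remainder_def)
    qed
    then show ?case using elim by (simp add: R_def)
  qed
  have grad_f1: "AE x in P. (\<Sum>i\<in>?I. (diff1 M i f1 x)\<^sup>2) \<le> b0\<^sup>2"
    using energy_cong_AE[OF F1m bounded_measurable_measurable[OF f1] F1] AE_space
  proof eventually_elim
    case (elim x)
    have "sqrt (\<Sum>i\<in>?I. (diff1 M i F1 x)\<^sup>2) \<le> b0"
      using assms(7) elim(2) unfolding F1_def grad_norm_eq by blast
    then have "(\<Sum>i\<in>?I. (diff1 M i F1 x)\<^sup>2) \<le> b0\<^sup>2" by (rule sqrt_le_D)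
    then show ?case by (simp only: elim(1))
  qed
  have U_meas: "grad_norm n M F2 \<in> borel_measurable P"
  proof -
    have "(\<lambda>x. \<Sum>i\<in>?I. (diff1 M i F2 x)\<^sup>2) \<in> borel_measurable P"
      by (intro borel_measurable_sum borel_measurable_power diff1_measurable F2m)
    then show ?thesis unfolding grad_norm_eq[abs_def] by measurable
  qed
  have U: "AE x in P. grad_norm n M F2 x = u x"
    using energy_cong_AE[OF F2m bounded_measurable_measurable[OF R] F2]
    by eventually_elim (simp only: grad_norm_eq u_def)
  have grad_u: "AE x in P. (\<Sum>i\<in>?I. (diff1 M i u x)\<^sup>2) \<le> 1"
    using energy_cong_AE[OF U_meas bounded_measurable_measurable[OF u] U] AE_space
  proof eventually_elim
    case (elim x)
    have "sqrt (\<Sum>i\<in>?I. (diff1 M i (grad_norm n M F2) x)\<^sup>2) \<le> 1"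
      using assms(8) elim(2) unfolding F2_def grad_norm_eq[of n M "grad_norm n M _"] by blast
    then show ?case using elim(1) by simp
  qed
  have grad_f: "AE x in P. (\<Sum>i\<in>?I. (diff1 M i f x)\<^sup>2) \<le> 2 * b0\<^sup>2 + 2 * (u x)\<^sup>2"
    using grad_f1 AE_space
  proof eventually_elim
    case (elim x)
    have "(\<lambda>x. f1 x + R x) = f" by (simp add: R_def)
    then have "(\<Sum>i\<in>?I. (diff1 M i f x)\<^sup>2) \<le> (\<Sum>i\<in>?I. 2 * (diff1 M i f1 x)\<^sup>2 + 2 * (diff1 M i R x)\<^sup>2)"
      using diff1_sq_add_le[OF f1 R _ elim(2)] by (intro sum_mono) simp
    also have "\<dots> = 2 * (\<Sum>i\<in>?I. (diff1 M i f1 x)\<^sup>2) + 2 * (u x)\<^sup>2"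
      by (simp only: sum.distrib sum_distrib_left usq)
    finally show ?case using elim(1) by linarith
  qed
  have "expectation (\<lambda>x. (u x)\<^sup>2) = expectation (\<lambda>x. \<Sum>i\<in>?I. (diff1 M i R x)\<^sup>2)" by (simp only: usq)
  also have "\<dots> \<le> expectation (\<lambda>x. \<Sum>i\<in>?I. \<Sum>j\<in>?I. (hess M f x i j)\<^sup>2)"
    using higher_order_part_energy[OF f assms(5)] unfolding R_def f1_def .
  also have "\<dots> = expectation (\<lambda>x. (hs_norm n (hess M f x))\<^sup>2)"
    by (intro Bochner_Integration.integral_cong refl) (simp add: hs_norm_def sum_nonneg)
  also have "\<dots> \<le> b\<^sup>2" by (rule assms(10))
  finally have ub: "expectation (\<lambda>x. (u x)\<^sup>2) \<le> b\<^sup>2" .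
  show ?thesis
    by (rule second_order_concentration[OF f assms(5) u u0 grad_f grad_u ub assms(6)])
qed

end
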